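(* Let $l$ be a prime with $l\equiv 4 \pmod 5$. Define $$f_0(x)=x^4+12x^3+14x^2-12x+1,\quad f_{1728}(x)=x^4+18x^3+74x^2-18x+1,$$ and for $j\in\mathbb{F}_l$, $f_j(x)=(x^4+12x^3+14x^2-12x+1)^3-jx^5(1-11x-x^2)\in\mathbb{F}_l[x]$. If $0$ is a supersingular $j$-invariant in characteristic $l$, then $f_0(x)$ has exactly $4$ distinct linear factors over $\mathbb{F}_l$; if $1728$ is a supersingular $j$-invariant in characteristic $l$, then $f_{1728}(x)$ has exactly $4$ distinct linear factors over $\mathbb{F}_l$; and if $j\in\mathbb{F}_l$, $j\neq 0,1728$, is a supersingular $j$-invariant in characteristic $l$, then $f_j(x)$ has exactly $4$ distinct linear factors over $\mathbb{F}_l$.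
   Context: A $j$-invariant $j\in\overline{\mathbb{F}}_l$ is supersingular if it is the $j$-invariant of a supersingular elliptic curve over $\overline{\mathbb{F}}_l$. *)

theory Defs
  imports "Berlekamp_Zassenhaus.Finite_Field" "HOL-Computational_Algebra.Polynomial"
begin

datatype 'k ec_point = Inf | Pt 'k 'k

definition on_curve :: "'k::field \<Rightarrow> 'k \<Rightarrow> 'k ec_point \<Rightarrow> bool" where
  "on_curve a b P = (case P of Inf \<Rightarrow> True | Pt x y \<Rightarrow> y^2 = x^3 + a*x + b)"

text \<open>Chord-and-tangent group law (valid in characteristic different from 2 and 3).\<close>
fun ec_add :: "'k::field \<Rightarrow> 'k ec_point \<Rightarrow> 'k ec_point \<Rightarrow> 'k ec_point" where
  "ec_add a Inf P = P"
| "ec_add a P Inf = P"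
| "ec_add a (Pt x1 y1) (Pt x2 y2) =
     (if x1 = x2 \<and> y1 = - y2 then Inf
      else let lam = (if x1 = x2 then (3 * x1^2 + a) / (2 * y1) else (y2 - y1) / (x2 - x1));
               x3 = lam^2 - x1 - x2
           in Pt x3 (lam * (x1 - x3) - y1))"

fun ec_mult :: "'k::field \<Rightarrow> nat \<Rightarrow> 'k ec_point \<Rightarrow> 'k ec_point" where
  "ec_mult a 0 P = Inf"
| "ec_mult a (Suc n) P = ec_add a P (ec_mult a n P)"

definition elliptic :: "'k::field \<Rightarrow> 'k \<Rightarrow> bool" where
  "elliptic a b = (4 * a^3 + 27 * b^2 \<noteq> 0)"

definition j_invariant :: "'k::field \<Rightarrow> 'k \<Rightarrow> 'k" where
  "j_invariant a b = 1728 * (4 * a^3) / (4 * a^3 + 27 * b^2)"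

text \<open>Supersingular (Silverman's definition): the l-torsion E[l] is trivial, l = characteristic.\<close>
definition supersingular_curve :: "nat \<Rightarrow> 'k::field \<Rightarrow> 'k \<Rightarrow> bool" where
  "supersingular_curve l a b =
     (\<forall>P. on_curve a b P \<and> ec_mult a l P = Inf \<longrightarrow> P = Inf)"

definition supersingular_j :: "nat \<Rightarrow> 'k::field \<Rightarrow> bool" where
  "supersingular_j l j =
     (\<exists>a b. elliptic a b \<and> j_invariant a b = j \<and> supersingular_curve l a b)"

definition is_alg_closure_of_Fp :: "nat \<Rightarrow> 'k::field itself \<Rightarrow> bool" where
  "is_alg_closure_of_Fp l _ =
     (prime l \<and> of_nat l = (0::'k)
      \<and> (\<forall>p::'k poly. degree p > 0 \<longrightarrow> (\<exists>x. poly p x = 0))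
      \<and> (\<forall>x::'k. \<exists>n>0. x ^ (l ^ n) = x))"

text \<open>Embedding of F_l = 'p mod_ring into a field of characteristic l.\<close>
definition emb :: "'p::prime_card mod_ring \<Rightarrow> 'k::field" where
  "emb j = of_int (to_int_mod_ring j)"

definition f0 :: "'a::comm_ring_1 poly" where
  "f0 = [:1, -12, 14, 12, 1:]"

definition f1728 :: "'a::comm_ring_1 poly" where
  "f1728 = [:1, -18, 74, 18, 1:]"

definition fj :: "'a::comm_ring_1 \<Rightarrow> 'a poly" where
  "fj j = [:1, -12, 14, 12, 1:] ^ 3 - smult j (monom 1 5 * [:1, -11, -1:])"

definition num_distinct_linear_factors :: "'a::field poly \<Rightarrow> nat" where
  "num_distinct_linear_factors f = card {g. monic g \<and> degree g = 1 \<and> g dvd f}"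

end

theory Submission
  imports Defs "HOL-Algebra.Sylow"
begin

text \<open>
  A supersingular invariant in \<open>F\<^sub>l\<close> has a model \<open>y\<^sup>2 = f(x)\<close> over \<open>F\<^sub>l\<close>. Counting points modulo \<open>l\<close>
  gives \<open>#E(F\<^sub>q) = 1 - A\<^sup>n\<close> for \<open>q = l\<^sup>n\<close> and \<open>A\<close> the Hasse invariant; if \<open>A\<close> were nonzero, \<open>n = l - 1\<close>
  would produce a point of order \<open>l\<close>. Hence \<open>A = 0\<close> and \<open>#E(F\<^sub>l)\<close> is \<open>1\<close>, \<open>l + 1\<close> or \<open>2l + 1\<close>; the
  extreme values would make \<open>f\<^bsup>(l-1)/2\<^esup>\<close> constant on \<open>F\<^sub>l\<close>, so that \<open>#E(F\<^sub>l) = l + 1\<close> is divisible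
  by 5. A rational point of order 5 puts the curve into Tate normal form with parameter \<open>t\<close>, and
  \<open>- t\<close> is a rational root of \<open>f\<^sub>j\<close>.

  One root determines the others. In terms of \<open>n = x - 1/x + 11\<close> the polynomial \<open>f\<^sub>j\<close> becomes a sextic
  in \<open>n\<close>. If \<open>n\<close> is a root, then \<open>125/n - 11 = y - 1/y\<close> with \<open>y\<close> rational, \<open>y = r\<^sup>5\<close> with \<open>r\<close>
  rational because \<open>5\<close> does not divide \<open>l - 1\<close>, and the remaining roots are \<open>n p\<^sup>6/125\<close> where
  \<open>p = zr - 1/(zr) + 1\<close> and \<open>z\<close> runs over the fifth roots of unity. Frobenius inverts \<open>z\<close>, so only
  \<open>z = 1\<close> gives a second rational root.
\<close>

section \<open>The group law\<close>

fun ec_neg :: "'k::field ec_point \<Rightarrow> 'k ec_point" where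
  "ec_neg Inf = Inf"
| "ec_neg (Pt x y) = Pt x (- y)"

lemma on_curve_simps [simp]:
  "on_curve a b Inf" "on_curve a b (Pt x y) \<longleftrightarrow> y^2 = x^3 + a*x + b"
  by (simp_all add: on_curve_def)

lemma ec_add_Inf_right [simp]: "ec_add a P Inf = P"
  by (cases P) auto

locale elliptic_curve =
  fixes a b :: "'k::field"
  assumes two_nonzero: "(2::'k) \<noteq> 0" and elliptic: "elliptic a b"
begin

abbreviation add (infixl "\<oplus>\<^sub>E" 65) where "P \<oplus>\<^sub>E Q \<equiv> ec_add a P Q"
abbreviation on where "on \<equiv> on_curve a b"

lemma on_neg [simp]: "on (ec_neg P) \<longleftrightarrow> on P"
  by (cases P) auto

lemma add_neg [simp]: "P \<oplus>\<^sub>E ec_neg P = Inf"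
  by (cases P) auto

text \<open>The two conditions on \<open>m\<close> characterise the slope of the chord and of the tangent
  at once, so that no later argument has to distinguish the two.\<close>

lemma add_slope:
  assumes "\<not> (x1 = x2 \<and> y1 = - y2)"
    and "y2 - y1 = m * (x2 - x1)"
    and "m * (y1 + y2) = x1^2 + x1*x2 + x2^2 + a"
  shows "Pt x1 y1 \<oplus>\<^sub>E Pt x2 y2 =
    Pt (m^2 - x1 - x2) (m * (x1 - (m^2 - x1 - x2)) - y1)"
proof (cases "x1 = x2")
  case False
  then have "(y2 - y1) / (x2 - x1) = m"
    using assms(2) by (simp add: field_simps)
  then show ?thesis using False by (simp add: Let_def)
next
  case True
  with assms have y: "y2 = y1" "y1 \<noteq> - y1" by auto
  then have "2 * y1 \<noteq> 0"
    by (metis add_cancel_right_left add_eq_0_iff mult_2)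
  moreover have "m * (2 * y1) = 3 * x1^2 + a"
    using assms(3) True y by (simp add: power2_eq_square algebra_simps)
  ultimately have "(3 * x1^2 + a) / (2 * y1) = m"
    by (simp add: nonzero_divide_eq_eq)
  then show ?thesis using True y by (simp add: Let_def)
qed

text \<open>For distinct abscissae the second equation is the difference of the two curve equations
  divided by \<open>x2 - x1\<close>. For equal abscissae the points coincide, the first equation is
  trivial and the tangent slope solves the second.\<close>

lemma slope_exists:
  assumes "on (Pt x1 y1)" "on (Pt x2 y2)" "\<not> (x1 = x2 \<and> y1 = - y2)"
  obtains m where "y2 - y1 = m * (x2 - x1)" "m * (y1 + y2) = x1^2 + x1*x2 + x2^2 + a"
proof (cases "x1 = x2")
  case False
  define m where "m = (y2 - y1) / (x2 - x1)"
  have m: "y2 - y1 = m * (x2 - x1)" using False by (simp add: m_def)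
  have "(x2 - x1) * (m * (y1 + y2)) = (y2 - y1) * (y1 + y2)"
    unfolding m by (simp add: mult_ac)
  also have "\<dots> = y2^2 - y1^2" by (simp add: algebra_simps power2_eq_square)
  also have "\<dots> = (x2^3 + a*x2 + b) - (x1^3 + a*x1 + b)" using assms by simp
  also have "\<dots> = (x2 - x1) * (x1^2 + x1*x2 + x2^2 + a)" by Groebner_Basis.algebra
  finally show thesis using that m False by simp
next
  case True
  have "(y2 - y1) * (y2 + y1) = y2^2 - y1^2" by (simp add: algebra_simps power2_eq_square)
  then have "(y2 - y1) * (y2 + y1) = 0" using assms True by simp
  then have y: "y2 = y1"
    using assms(3) True by (auto simp: add_eq_0_iff)
  have "2 * y1 \<noteq> 0"
    using assms(3) True y two_nonzero by (auto simp: eq_neg_iff_add_eq_0)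
  then have "(3 * x1^2 + a) / (2 * y1) * (y1 + y2) = 3 * x1^2 + a"
    unfolding y by (metis mult_2 nonzero_divide_eq_eq)
  then show thesis
    using that[of "(3 * x1^2 + a) / (2 * y1)"] True y
    by (simp add: power2_eq_square)
qed

lemma add_commute: "on P \<Longrightarrow> on Q \<Longrightarrow> P \<oplus>\<^sub>E Q = Q \<oplus>\<^sub>E P"
proof (cases P; cases Q)
  fix x1 y1 x2 y2 assume *: "on P" "on Q" "P = Pt x1 y1" "Q = Pt x2 y2"
  show "P \<oplus>\<^sub>E Q = Q \<oplus>\<^sub>E P"
  proof (cases "x1 = x2 \<and> y1 = - y2")
    case False
    obtain m where m: "y2 - y1 = m * (x2 - x1)" "m * (y1 + y2) = x1^2 + x1*x2 + x2^2 + a"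
      using slope_exists * False by metis
    have 1: "P \<oplus>\<^sub>E Q = Pt (m^2 - x1 - x2) (m * (x1 - (m^2 - x1 - x2)) - y1)"
      using add_slope[OF False m] * by simp
    have "\<not> (x2 = x1 \<and> y2 = - y1)" "y1 - y2 = m * (x1 - x2)"
      "m * (y2 + y1) = x2^2 + x2*x1 + x1^2 + a"
      using False m by (auto simp: algebra_simps)
    from add_slope[OF this]
    have 2: "Q \<oplus>\<^sub>E P = Pt (m^2 - x2 - x1) (m * (x2 - (m^2 - x2 - x1)) - y2)"
      using * by simp
    show ?thesis unfolding 1 2 using m(1) by (simp add: algebra_simps)
  qed (use * in auto)
qed auto

lemma on_add [simp]:
  assumes "on P" "on Q" shows "on (P \<oplus>\<^sub>E Q)"
proof (cases P; cases Q)
  fix x1 y1 x2 y2 assume *: "P = Pt x1 y1" "Q = Pt x2 y2"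
  show ?thesis
  proof (cases "x1 = x2 \<and> y1 = - y2")
    case False
    obtain m where m: "y2 - y1 = m * (x2 - x1)" "m * (y1 + y2) = x1^2 + x1*x2 + x2^2 + a"
      using slope_exists * False assms by metis
    have y2: "y2 = y1 + m * (x2 - x1)" using m(1) by (simp add: algebra_simps)
    have a: "a = m * (y1 + y2) - x1^2 - x1*x2 - x2^2" using m(2) by simp
    have b: "b = y1^2 - x1^3 - a*x1" using assms * by simp
    have "on (Pt (m^2 - x1 - x2) (m * (x1 - (m^2 - x1 - x2)) - y1))"
      unfolding on_curve_simps b unfolding a y2 by Groebner_Basis.algebra
    then show ?thesis using add_slope[OF False m] * by simp
  qed (use * in auto)
qed (use assms in auto)

text \<open>The hypotheses make \<open>x\<close> a double root of the cubic, so
  \<open>a = - 3x^2\<close>, \<open>b = 2x^3\<close> and the discriminant vanishes.\<close>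

lemma nonsingular:
  assumes "x^3 + a*x + b = 0" "3 * x^2 + a = 0" shows False
proof -
  have a: "a = - (3 * x^2)" using assms(2) by (simp add: eq_neg_iff_add_eq_0 add.commute)
  have "b = - (x^3) - a*x" using assms(1) by (simp add: algebra_simps eq_neg_iff_add_eq_0)
  then have b: "b = 2 * x^3" unfolding a by (simp add: power2_eq_square power3_eq_cube)
  have "4 * a^3 + 27 * b^2 = 0" unfolding a b by Groebner_Basis.algebra
  then show False using elliptic by (simp add: elliptic_def)
qed

text \<open>Proved before associativity, which relies on it. Reflecting the line through
  \<open>P\<close> and \<open>Q\<close> gives a line of slope \<open>- m\<close> through
  \<open>P + Q\<close>, \<open>- Q\<close> and \<open>- P\<close>, so the sum of the first two is
  \<open>P\<close>.\<close>

lemma add_neg_cancel: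
  assumes "on P" "on Q" shows "(P \<oplus>\<^sub>E Q) \<oplus>\<^sub>E ec_neg Q = P"
proof (cases P; cases Q)
  fix x1 y1 x2 y2 assume *: "P = Pt x1 y1" "Q = Pt x2 y2"
  show ?thesis
  proof (cases "x1 = x2 \<and> y1 = - y2")
    case False
    obtain m where m: "y2 - y1 = m * (x2 - x1)" "m * (y1 + y2) = x1^2 + x1*x2 + x2^2 + a"
      using slope_exists * False assms by metis
    define x3 y3 where "x3 = m^2 - x1 - x2" and "y3 = m * (x1 - x3) - y1"
    have R: "P \<oplus>\<^sub>E Q = Pt x3 y3"
      using add_slope[OF False m] * by (simp add: x3_def y3_def)
    have s: "- y2 - y3 = (- m) * (x2 - x3)"
      using m by (simp add: y3_def algebra_simps)
    have t: "(- m) * (y3 + - y2) = x3^2 + x3*x2 + x2^2 + a"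
    proof -
      have y2: "y2 = y1 + m * (x2 - x1)" using m(1) by (simp add: algebra_simps)
      have a: "a = m * (y1 + y2) - x1^2 - x1*x2 - x2^2" using m(2) by simp
      show ?thesis unfolding y3_def x3_def a y2 by Groebner_Basis.algebra
    qed
    \<comment> \<open>The case to exclude is \<open>P + Q = Q\<close>; the slope conditions would
      turn \<open>Q\<close> into a singular point.\<close>
    have n: "\<not> (x3 = x2 \<and> y3 = - (- y2))"
    proof
      assume eq: "x3 = x2 \<and> y3 = - (- y2)"
      with s have "2 * y2 = 0" by simp
      then have "y2 = 0" using two_nonzero by simp
      moreover have "3 * x2^2 + a = 0"
        using t eq by (simp add: algebra_simps power2_eq_square)
      ultimately show False using nonsingular[of x2] assms * by simp
    qed
    from add_slope[OF n s t]
    have "Pt x3 y3 \<oplus>\<^sub>E Pt x2 (- y2) = Pt (m^2 - x3 - x2) (- m * (x3 - (m^2 - x3 - x2)) - y3)"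
      by simp
    moreover have "m^2 - x3 - x2 = x1" by (simp add: x3_def)
    ultimately show ?thesis using R * by (simp add: y3_def algebra_simps)
  qed (use * in auto)
qed (use assms in auto)

lemma add_right_cancel:
  assumes "on P" "on Q" "on R" "P \<oplus>\<^sub>E R = Q \<oplus>\<^sub>E R" shows "P = Q"
  using add_neg_cancel assms by metis

text \<open>Writing \<open>m\<close>, \<open>m'\<close> for the slopes of \<open>P\<^sub>1P\<^sub>2\<close>, \<open>P\<^sub>2P\<^sub>3\<close> and \<open>t = (x\<^sub>1 - x\<^sub>3) / (m' - m)\<close>,
  the two remaining slopes are \<open>- m - t\<close> and \<open>- m' - t\<close>.\<close>

lemma add_assoc_generic:
  assumes on: "on (Pt x1 y1)" "on (Pt x2 y2)" "on (Pt x3 y3)"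
    and ne: "x1 \<noteq> x2" "x1 \<noteq> x3" "\<not> (x2 = x3 \<and> y2 = - y3)"
    and s12: "Pt x1 y1 \<oplus>\<^sub>E Pt x2 y2 = Pt x12 y12" and n12: "x12 \<noteq> x3"
    and s23: "Pt x2 y2 \<oplus>\<^sub>E Pt x3 y3 = Pt x23 y23" and n23: "x1 \<noteq> x23"
  shows "Pt x1 y1 \<oplus>\<^sub>E (Pt x2 y2 \<oplus>\<^sub>E Pt x3 y3) = (Pt x1 y1 \<oplus>\<^sub>E Pt x2 y2) \<oplus>\<^sub>E Pt x3 y3"
proof -
  have ne12: "\<not> (x1 = x2 \<and> y1 = - y2)" using ne by simp
  obtain m where m: "y2 - y1 = m * (x2 - x1)" "m * (y1 + y2) = x1^2 + x1*x2 + x2^2 + a"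
    using slope_exists on ne12 by metis
  obtain m' where m': "y3 - y2 = m' * (x3 - x2)" "m' * (y2 + y3) = x2^2 + x2*x3 + x3^2 + a"
    using slope_exists on ne by metis
  have x12: "x12 = m^2 - x1 - x2" and y12: "y12 = m * (x1 - x12) - y1"
    using add_slope[OF ne12 m] s12 by auto
  have x23: "x23 = m'^2 - x2 - x3" and y23: "y23 = m' * (x2 - x23) - y2"
    using add_slope[OF ne(3) m'] s23 by auto
  have y1: "y1 = y2 - m * (x2 - x1)" and y3: "y3 = y2 + m' * (x3 - x2)"
    using m(1) m'(1) by (simp_all add: algebra_simps)
  have "m' * (y2 + y3) - m * (y1 + y2) = (x2^2 + x2*x3 + x3^2) - (x1^2 + x1*x2 + x2^2)"
    using m(2) m'(2) by simp
  \<comment> \<open>Here \<open>a\<close> has been eliminated from the two slope conditions. The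
    coordinate identities below are combinations of this relation and the one defining
    \<open>t\<close>.\<close>
  then have rel: "2 * y2 * (m' - m) = (x1 - x2) * (x12 - x3) - (x3 - x2) * (x23 - x1)"
    unfolding y1 y3 x12 x23 by (simp add: algebra_simps power2_eq_square)
  have mm': "m \<noteq> m'"
  proof
    assume eq: "m = m'"
    then have "x23 - x1 = x12 - x3" unfolding x12 x23 by simp
    then have "(x1 - x2) * (x12 - x3) - (x3 - x2) * (x12 - x3) = 0"
      using rel eq by simp
    then have "(x1 - x3) * (x12 - x3) = 0"
      by (simp add: algebra_simps)
    then show False using ne(2) n12 by simp
  qed
  define t where "t = (x1 - x3) / (m' - m)"
  have t: "t * (m' - m) = x1 - x3" using mm' by (simp add: t_def)
  have "(m' - m) * (y3 - y12) - (m' - m) * ((- m - t) * (x3 - x12)) =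
      (2 * y2 * (m' - m) - ((x1 - x2) * (x12 - x3) - (x3 - x2) * (x23 - x1))) +
      (x3 - x12) * (t * (m' - m) - (x1 - x3))"
    unfolding y12 y1 y3 x12 x23 by Groebner_Basis.algebra
  then have a1: "y3 - y12 = (- m - t) * (x3 - x12)" using mm' rel t by simp
  have "(m' - m) * (y23 - y1) - (m' - m) * ((- m' - t) * (x23 - x1)) =
      - (2 * y2 * (m' - m) - ((x1 - x2) * (x12 - x3) - (x3 - x2) * (x23 - x1))) +
      (x23 - x1) * (t * (m' - m) - (x1 - x3))"
    unfolding y23 y1 x12 x23 by Groebner_Basis.algebra
  then have b1: "y23 - y1 = (- m' - t) * (x23 - x1)" using mm' rel t by simp
  have "(y3 - y12) / (x3 - x12) = - m - t" "(y23 - y1) / (x23 - x1) = - m' - t"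
    using a1 b1 n12 n23 by (simp_all add: nonzero_divide_eq_eq)
  then have
    L: "Pt x1 y1 \<oplus>\<^sub>E Pt x23 y23 = Pt ((- m' - t)^2 - x1 - x23)
          ((- m' - t) * (x1 - ((- m' - t)^2 - x1 - x23)) - y1)" and
    R: "Pt x12 y12 \<oplus>\<^sub>E Pt x3 y3 = Pt ((- m - t)^2 - x12 - x3)
          ((- m - t) * (x12 - ((- m - t)^2 - x12 - x3)) - y12)"
    using n12 n23 by (auto simp: Let_def)
  have X: "(- m' - t)^2 - x1 - x23 = (- m - t)^2 - x12 - x3"
  proof -
    have "(- m' - t)^2 - x1 - x23 - ((- m - t)^2 - x12 - x3) = 2 * (t * (m' - m) - (x1 - x3))"
      unfolding x12 x23 by Groebner_Basis.algebra
    then show ?thesis using t by simp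
  qed
  have Y: "(- m' - t) * (x1 - ((- m - t)^2 - x12 - x3)) - y1 =
      (- m - t) * (x12 - ((- m - t)^2 - x12 - x3)) - y12"
  proof -
    have "(- m' - t) * (x1 - ((- m - t)^2 - x12 - x3)) - y1 -
        ((- m - t) * (x12 - ((- m - t)^2 - x12 - x3)) - y12) =
        (2 * m + t) * (t * (m' - m) - (x1 - x3)) - (y3 - y12 - (- m - t) * (x3 - x12))"
      unfolding y1 y3 x12 by Groebner_Basis.algebra
    then show ?thesis using t a1 by simp
  qed
  show ?thesis unfolding s12 s23 L R X using Y by simp
qed

lemma finite_on_fibre: "finite {P. on P \<and> (\<exists>y. P = Pt x y)}"
proof -
  have "finite {y. poly [:-(x^3 + a*x + b), 0, 1:] y = 0}"
    by (rule poly_roots_finite) simp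
  moreover have "{P. on P \<and> (\<exists>y. P = Pt x y)} \<subseteq> Pt x ` {y. poly [:-(x^3 + a*x + b), 0, 1:] y = 0}"
    by (auto simp: power2_eq_square)
  ultimately show ?thesis by (meson finite_imageI finite_subset)
qed

lemma finite_add_preimage:
  assumes "on Q" "finite Z" shows "finite {S. on S \<and> S \<oplus>\<^sub>E Q \<in> Z}"
proof (rule finite_subset)
  show "{S. on S \<and> S \<oplus>\<^sub>E Q \<in> Z} \<subseteq> (\<lambda>R. R \<oplus>\<^sub>E ec_neg Q) ` Z"
    using add_neg_cancel[OF _ assms(1)] by (force simp: image_iff)
qed (use assms in simp)

text \<open>Apart from degenerate \<open>P\<close>, \<open>Q\<close>, the generic case fails only if
  \<open>S\<close> is \<open>Inf\<close>, shares its abscissa with \<open>P\<close>,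
  \<open>Q\<close> or \<open>P + Q\<close>, or if \<open>S + P\<close> is \<open>Inf\<close> or
  shares its abscissa with \<open>Q\<close>. Each condition holds for finitely many
  \<open>S\<close>.\<close>

lemma add_assoc_cofinite:
  assumes "on P" "on Q"
  shows "finite {S. on S \<and> S \<oplus>\<^sub>E (P \<oplus>\<^sub>E Q) \<noteq> (S \<oplus>\<^sub>E P) \<oplus>\<^sub>E Q}"
proof (cases "P = Inf \<or> Q = Inf \<or> Q = ec_neg P")
  case True
  then have "{S. on S \<and> S \<oplus>\<^sub>E (P \<oplus>\<^sub>E Q) \<noteq> (S \<oplus>\<^sub>E P) \<oplus>\<^sub>E Q} = {}"
    using add_neg_cancel assms by auto
  then show ?thesis by (metis finite.emptyI)
next
  case False
  then obtain x2 y2 x3 y3 where P: "P = Pt x2 y2" and Q: "Q = Pt x3 y3"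
    by (metis ec_point.exhaust)
  have ne: "\<not> (x2 = x3 \<and> y2 = - y3)" using False P Q by auto
  then obtain x23 y23 where s23: "P \<oplus>\<^sub>E Q = Pt x23 y23"
    unfolding P Q by (auto simp: Let_def)
  let ?F = "\<lambda>x. {S. on S \<and> (\<exists>y. S = Pt x y)}"
  have "{S. on S \<and> S \<oplus>\<^sub>E (P \<oplus>\<^sub>E Q) \<noteq> (S \<oplus>\<^sub>E P) \<oplus>\<^sub>E Q} \<subseteq>
    {Inf} \<union> ?F x2 \<union> ?F x3 \<union> ?F x23 \<union> {S. on S \<and> S \<oplus>\<^sub>E P \<in> {Inf} \<union> ?F x3}"
  proof (rule subsetI, rule ccontr)
    fix S assume S: "S \<in> {S. on S \<and> S \<oplus>\<^sub>E (P \<oplus>\<^sub>E Q) \<noteq> (S \<oplus>\<^sub>E P) \<oplus>\<^sub>E Q}"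
      and nS: "S \<notin> {Inf} \<union> ?F x2 \<union> ?F x3 \<union> ?F x23 \<union> {S. on S \<and> S \<oplus>\<^sub>E P \<in> {Inf} \<union> ?F x3}"
    from S have "on S" by simp
    obtain x1 y1 where S1: "S = Pt x1 y1" using nS by (cases S) auto
    obtain x12 y12 where s12: "S \<oplus>\<^sub>E P = Pt x12 y12"
      using nS \<open>on S\<close> by (cases "S \<oplus>\<^sub>E P") auto
    have "on (Pt x12 y12)" using s12 \<open>on S\<close> assms by (metis on_add)
    then have "x1 \<noteq> x2" "x1 \<noteq> x3" "x12 \<noteq> x3" "x1 \<noteq> x23"
      using nS \<open>on S\<close> s12 S1 by auto
    then have "S \<oplus>\<^sub>E (P \<oplus>\<^sub>E Q) = (S \<oplus>\<^sub>E P) \<oplus>\<^sub>E Q"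
      unfolding S1 P Q
      using add_assoc_generic \<open>on S\<close> assms ne s12 s23 unfolding S1 P Q by blast
    then show False using S by simp
  qed
  moreover have "finite ({Inf} \<union> ?F x2 \<union> ?F x3 \<union> ?F x23 \<union> {S. on S \<and> S \<oplus>\<^sub>E P \<in> {Inf} \<union> ?F x3})"
    using assms by (intro finite_UnI finite_on_fibre finite_add_preimage) simp_all
  ultimately show ?thesis by (rule finite_subset)
qed

text \<open>Both sides agree after adding a sufficiently general point, which can then be cancelled.\<close>

lemma add_assoc:
  assumes inf: "infinite {P. on P}" and on: "on P" "on Q" "on R"
  shows "P \<oplus>\<^sub>E (Q \<oplus>\<^sub>E R) = (P \<oplus>\<^sub>E Q) \<oplus>\<^sub>E R"
proof -
  let ?bad = "\<lambda>P Q. {S. on S \<and> S \<oplus>\<^sub>E (P \<oplus>\<^sub>E Q) \<noteq> (S \<oplus>\<^sub>E P) \<oplus>\<^sub>E Q}"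
  have "finite (?bad P (Q \<oplus>\<^sub>E R) \<union> ?bad (P \<oplus>\<^sub>E Q) R \<union> ?bad P Q \<union>
      {S. on S \<and> S \<oplus>\<^sub>E P \<in> ?bad Q R})" (is "finite ?B")
    using on by (intro finite_UnI add_assoc_cofinite finite_add_preimage) simp_all
  then have "{P. on P} - ?B \<noteq> {}"
    using Diff_infinite_finite[OF _ inf, of ?B] infinite_imp_nonempty by blast
  then obtain S where S: "on S" "S \<notin> ?B" by auto
  have "S \<oplus>\<^sub>E (P \<oplus>\<^sub>E (Q \<oplus>\<^sub>E R)) = S \<oplus>\<^sub>E P \<oplus>\<^sub>E (Q \<oplus>\<^sub>E R)" using S by auto
  also have "\<dots> = S \<oplus>\<^sub>E P \<oplus>\<^sub>E Q \<oplus>\<^sub>E R" using S on by auto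
  also have "\<dots> = S \<oplus>\<^sub>E (P \<oplus>\<^sub>E Q \<oplus>\<^sub>E R)" using S by auto
  finally show ?thesis
    using add_right_cancel[of "P \<oplus>\<^sub>E (Q \<oplus>\<^sub>E R)" "P \<oplus>\<^sub>E Q \<oplus>\<^sub>E R" S] add_commute S on by simp
qed

end

section \<open>Finite subfields of the algebraic closure\<close>

text \<open>Split off one linear factor, \<open>p = (X - c) q\<close>. The product rule gives
  \<open>p'(c) = q(c)\<close>, so \<open>c\<close> is not a root of \<open>q\<close>, and
  \<open>q\<close> is again separable.\<close>

lemma card_roots_separable:
  fixes p :: "'k::field poly"
  assumes closed: "\<And>p::'k poly. degree p > 0 \<Longrightarrow> \<exists>x. poly p x = 0"
    and "p \<noteq> 0" "\<And>x. poly p x = 0 \<Longrightarrow> poly (pderiv p) x \<noteq> 0"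
  shows "card {x. poly p x = 0} = degree p"
  using assms(2,3)
proof (induction "degree p" arbitrary: p rule: less_induct)
  case less
  show ?case
  proof (cases "degree p = 0")
    case True
    then obtain c where "p = [:c:]" by (metis degree_eq_zeroE)
    with less.prems(1) show ?thesis by simp
  next
    case False
    then obtain c where "poly p c = 0" using closed by blast
    then obtain q where p: "p = [:-c, 1:] * q"
      by (metis dvdE poly_eq_0_iff_dvd)
    have q: "q \<noteq> 0" using p less.prems(1) by auto
    have deg: "degree p = Suc (degree q)"
      unfolding p using q by (subst degree_mult_eq) auto
    have d: "poly (pderiv p) x = poly q x + (x - c) * poly (pderiv q) x" for x
      unfolding p pderiv_mult by (simp add: pderiv_pCons algebra_simps)
    have qc: "poly q c \<noteq> 0"
      using less.prems(2)[of c] d[of c] \<open>poly p c = 0\<close> by simp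
    have "card {x. poly q x = 0} = degree q"
    proof (rule less.hyps)
      fix x assume "poly q x = 0"
      then show "poly (pderiv q) x \<noteq> 0"
        using less.prems(2)[of x] d[of x] by (auto simp: p)
    qed (use q deg in auto)
    moreover have "{x. poly p x = 0} = insert c {x. poly q x = 0}"
      by (auto simp: p)
    ultimately show ?thesis
      using qc deg poly_roots_finite[OF q] by simp
  qed
qed

locale alg_closed_field_pchar =
  fixes K :: "'k::field itself" and l :: nat
  assumes prime_l: "prime l" and CHAR_eq: "CHAR('k) = l"
    and closed: "\<And>p::'k poly. degree p > 0 \<Longrightarrow> \<exists>x. poly p x = 0"
begin

lemma l_gt_1: "l > 1" using prime_l prime_gt_1_nat by blast

lemma of_nat_l [simp]: "of_nat l = (0::'k)" using CHAR_eq of_nat_CHAR by metis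

text \<open>The subfield with \<open>l^n\<close> elements as the fixed points of the
  \<open>n\<close>-th power of Frobenius. For \<open>n = 0\<close> this is the whole field, hence
  the hypotheses \<open>n > 0\<close> in the counting lemmas.\<close>

definition Fq :: "nat \<Rightarrow> 'k set" where "Fq n = {x. x ^ (l^n) = x}"

lemma frob_add: "(x + y :: 'k) ^ (l^n) = x ^ (l^n) + y ^ (l^n)"
  using freshmans_dream'[of "l^n" n x y] prime_l CHAR_eq by simp

lemma q_gt_1: "n > 0 \<Longrightarrow> l^n > 1"
  using l_gt_1 by (rule one_less_power)

lemma Fq_0 [simp]: "0 \<in> Fq n" using l_gt_1 by (simp add: Fq_def power_0_left)
lemma Fq_1 [simp]: "1 \<in> Fq n" by (simp add: Fq_def)
lemma Fq_add [intro]: "x \<in> Fq n \<Longrightarrow> y \<in> Fq n \<Longrightarrow> x + y \<in> Fq n"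
  by (simp add: Fq_def frob_add)
lemma Fq_mult [intro]: "x \<in> Fq n \<Longrightarrow> y \<in> Fq n \<Longrightarrow> x * y \<in> Fq n"
  by (simp add: Fq_def power_mult_distrib)
lemma Fq_uminus [intro]: "x \<in> Fq n \<Longrightarrow> - x \<in> Fq n"
proof -
  assume "x \<in> Fq n"
  moreover have "x ^ (l^n) + (- x) ^ (l^n) = 0"
    using frob_add[of x "- x" n] l_gt_1 by (simp add: power_0_left)
  ultimately show ?thesis by (simp add: Fq_def eq_neg_iff_add_eq_0 add.commute)
qed
lemma Fq_diff [intro]: "x \<in> Fq n \<Longrightarrow> y \<in> Fq n \<Longrightarrow> x - y \<in> Fq n"
  using Fq_add[of x n "- y"] by auto
lemma Fq_divide [intro]: "x \<in> Fq n \<Longrightarrow> y \<in> Fq n \<Longrightarrow> x / y \<in> Fq n"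
  by (simp add: Fq_def power_divide)
lemma Fq_power [intro]: "x \<in> Fq n \<Longrightarrow> x ^ m \<in> Fq n"
  by (induction m) auto
lemma Fq_of_nat [simp]: "of_nat m \<in> Fq n"
  by (induction m) auto
lemma Fq_numeral [simp]: "numeral m \<in> Fq n"
  using Fq_of_nat[of "numeral m"] by simp

lemma Fq_mono: "x \<in> Fq 1 \<Longrightarrow> x \<in> Fq n"
  by (induction n) (auto simp: Fq_def power_mult)

text \<open>The polynomial \<open>X^q - X\<close> with \<open>q = l^n\<close> has derivative
  \<open>- 1\<close>, hence \<open>q\<close> distinct roots.\<close>

lemma finite_card_Fq:
  assumes "n > 0" shows "finite (Fq n)" "card (Fq n) = l^n"
proof -
  let ?p = "monom 1 (l^n) - [:0, 1:] :: 'k poly"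
  have root: "poly ?p x = 0 \<longleftrightarrow> x \<in> Fq n" for x
    by (simp add: Fq_def poly_monom)
  have "degree [:0, 1 :: 'k:] < degree (monom (1::'k) (l^n))"
    using q_gt_1[OF assms] by (simp add: degree_monom_eq)
  then have deg: "degree ?p = l^n"
    using degree_add_eq_left[of "- [:0, 1:]" "monom (1::'k) (l^n)"]
    unfolding diff_conv_add_uminus degree_minus by (metis degree_monom_eq one_neq_zero)
  then have p0: "?p \<noteq> 0" using q_gt_1[OF assms] by (metis degree_0 not_one_less_zero)
  have "of_nat (l^n) = (0::'k)" using assms by simp
  then have "pderiv ?p = [:-1:]"
    using assms by (simp add: pderiv_diff pderiv_monom pderiv_pCons power_0_left)
  then have "card {x. poly ?p x = 0} = degree ?p"
    by (intro card_roots_separable closed p0) auto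
  then show "card (Fq n) = l^n" using root deg by simp
  show "finite (Fq n)" using poly_roots_finite[OF p0] root by simp
qed

lemma Fq_power_minus_1:
  assumes "x \<in> Fq n" "x \<noteq> 0" shows "x ^ (l^n - 1) = 1"
proof -
  have "x ^ (l^n - 1) * x = x"
    using assms l_gt_1 by (simp add: Fq_def flip: power_Suc2)
  then show ?thesis using assms by simp
qed

text \<open>Substituting \<open>g * x\<close> for \<open>x\<close> multiplies the sum by
  \<open>g^i\<close>. A suitable \<open>g\<close> with \<open>g^i\<close> different from 1 exists
  because \<open>X^i - 1\<close> has at most \<open>i < l^n - 1\<close> roots.\<close>

lemma sum_power_Fq_0:
  assumes "n > 0" "0 < i" "i < l^n - 1" shows "(\<Sum>x\<in>Fq n. x^i) = 0"
proof -
  note fin = finite_card_Fq[OF \<open>n > 0\<close>]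
  have "\<exists>g\<in>Fq n - {0}. g^i \<noteq> 1"
  proof (rule ccontr)
    assume *: "\<not> ?thesis"
    let ?p = "monom 1 i - 1 :: 'k poly"
    have "degree (1 :: 'k poly) < degree (monom (1::'k) i)"
      using assms by (simp add: degree_monom_eq)
    then have deg: "degree ?p = i"
      using degree_add_eq_left[of "- 1" "monom (1::'k) i"] by (simp add: degree_monom_eq)
    then have p0: "?p \<noteq> 0" using assms by force
    have "Fq n - {0} \<subseteq> {x. poly ?p x = 0}"
      using * by (auto simp: poly_monom)
    then have "card (Fq n - {0}) \<le> card {x. poly ?p x = 0}"
      using poly_roots_finite[OF p0] card_mono by blast
    also have "\<dots> \<le> i" using card_poly_roots_bound[OF p0] deg by simp
    finally show False using assms fin by simp
  qed
  then obtain g where g: "g \<in> Fq n" "g \<noteq> 0" "g^i \<noteq> 1" by blast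
  have "(\<Sum>x\<in>Fq n. x^i) = (\<Sum>x\<in>Fq n. (g*x)^i)"
    by (rule sum.reindex_bij_witness[of _ "\<lambda>x. g*x" "\<lambda>x. x/g"]) (use g in auto)
  also have "\<dots> = g^i * (\<Sum>x\<in>Fq n. x^i)"
    by (simp add: power_mult_distrib sum_distrib_left)
  finally have "(1 - g^i) * (\<Sum>x\<in>Fq n. x^i) = 0" by (simp add: algebra_simps)
  then show ?thesis using g by simp
qed

lemma sum_power_Fq:
  assumes "n > 0" "l \<noteq> 2" "i < 2 * (l^n - 1)"
  shows "(\<Sum>x\<in>Fq n. x^i) = (if i = l^n - 1 then -1 else 0)"
proof -
  note fin = finite_card_Fq[OF \<open>n > 0\<close>]
  note q = q_gt_1[OF \<open>n > 0\<close>]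
  consider "i = 0" | "0 < i" "i < l^n - 1" | "i = l^n - 1" | "i > l^n - 1" by linarith
  then show ?thesis
  proof cases
    case 1
    then show ?thesis using fin q assms by simp
  next
    case 2
    then show ?thesis using sum_power_Fq_0 assms by simp
  next
    case 3
    then have "(\<Sum>x\<in>Fq n. x^i) = (\<Sum>x\<in>Fq n - {0}. x^i)"
      using fin q by (subst sum.remove[of _ 0]) (auto simp: power_0_left)
    also have "\<dots> = (\<Sum>x\<in>Fq n - {0}. 1)"
      by (rule sum.cong) (use 3 Fq_power_minus_1 in auto)
    also have "\<dots> = of_nat (l^n - 1)" using fin by simp
    also have "\<dots> = of_nat (l^n) - 1" using q by (subst of_nat_diff) auto
    finally show ?thesis using assms 3 by simp
  next
    case 4
    \<comment> \<open>On \<open>Fq n\<close> the rule \<open>x^q = x\<close> lowers the exponent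
      \<open>i\<close> to \<open>Suc k\<close>, which lies strictly between \<open>0\<close> and
      \<open>q - 1\<close>.\<close>
    define k where "k = i - l^n"
    have k: "i = l^n + k" using 4 by (simp add: k_def)
    have "(\<Sum>x\<in>Fq n. x^i) = (\<Sum>x\<in>Fq n. x^(Suc k))"
      by (rule sum.cong) (auto simp: k power_add Fq_def)
    also have "\<dots> = 0"
      using assms k by (intro sum_power_Fq_0) auto
    finally show ?thesis using 4 by simp
  qed
qed

lemma sum_poly_Fq:
  fixes p :: "'k poly"
  assumes "n > 0" "l \<noteq> 2" "degree p < 2 * (l^n - 1)"
  shows "(\<Sum>x\<in>Fq n. poly p x) = - coeff p (l^n - 1)"
proof -
  have "(\<Sum>x\<in>Fq n. poly p x) = (\<Sum>i\<le>degree p. coeff p i * (\<Sum>x\<in>Fq n. x^i))"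
    unfolding poly_altdef by (subst sum.swap) (simp add: sum_distrib_left)
  also have "\<dots> = (\<Sum>i\<le>degree p. if i = l^n - 1 then - coeff p i else 0)"
    by (rule sum.cong) (use assms in \<open>auto simp: sum_power_Fq\<close>)
  also have "\<dots> = - coeff p (l^n - 1)"
    using coeff_eq_0[of p "l^n - 1"] by (auto simp: sum.delta)
  finally show ?thesis .
qed

lemma sqrt_exists: "\<exists>y::'k. y^2 = c"
proof -
  obtain y where "poly [:-c, 0, 1:] y = 0" using closed[of "[:-c, 0, 1:]"] by auto
  then show ?thesis by (auto simp: power2_eq_square)
qed

lemma two_nonzero_if_odd: "l \<noteq> 2 \<Longrightarrow> (2::'k) \<noteq> 0"
  using of_nat_eq_0_iff_char_dvd[of 2, where 'a='k] prime_l CHAR_eq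
  by (metis of_nat_numeral primes_dvd_imp_eq two_is_prime_nat)

lemma odd_l: "l \<noteq> 2 \<Longrightarrow> odd (l^n)"
  using prime_l prime_odd_nat[of l] l_gt_1 by auto

text \<open>Euler's criterion as an identity in characteristic \<open>l\<close>. A square root
  \<open>y\<close> of \<open>c\<close> in the closure satisfies
  \<open>y^(q-1) = c^((q-1)/2)\<close>, and a nonzero \<open>y\<close> lies in \<open>Fq n\<close>
  exactly when this value is 1.\<close>

lemma card_sqrt_Fq:
  assumes "n > 0" "l \<noteq> 2" "c \<in> Fq n"
  shows "of_nat (card {y\<in>Fq n. y^2 = c}) = 1 + c ^ ((l^n - 1) div 2)"
proof (cases "c = 0")
  case True
  then have "{y\<in>Fq n. y^2 = c} = {0}" by auto
  moreover have "l^n \<ge> 3"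
    using q_gt_1[OF assms(1)] odd_l[OF assms(2), of n] by (cases "l^n = 2") auto
  then have "(l^n - 1) div 2 > 0" by linarith
  ultimately show ?thesis using True by (simp add: power_0_left)
next
  case False
  define e where "e = c ^ ((l^n - 1) div 2)"
  have half: "2 * ((l^n - 1) div 2) = l^n - 1"
    using odd_l[OF assms(2), of n] by simp
  have ye: "y ^ (l^n - 1) = e" if "y^2 = c" for y
    unfolding e_def that[symmetric] by (simp only: half flip: power_mult)
  have "e^2 = 1"
    unfolding e_def using Fq_power_minus_1[OF assms(3) False]
    by (simp only: half mult.commute flip: power_mult)
  then have e: "e = 1 \<or> e = - 1" by (simp add: power2_eq_1_iff)
  have neq: "(1::'k) \<noteq> - 1" using two_nonzero_if_odd[OF assms(2)]
    by (simp add: eq_neg_iff_add_eq_0)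
  show ?thesis
  proof (cases "e = 1")
    case True
    obtain y where y: "y^2 = c" using sqrt_exists by blast
    have "y ^ (l^n) = y ^ (l^n - 1) * y" using q_gt_1[OF assms(1)]
      by (metis Suc_diff_1 less_trans power_Suc2 zero_less_one)
    then have "y \<in> Fq n" using ye[OF y] True by (simp add: Fq_def)
    then have "{y\<in>Fq n. y^2 = c} = {y, - y}"
      using y by (auto simp: power2_eq_iff)
    moreover have "y \<noteq> - y"
      using y False two_nonzero_if_odd[OF assms(2)] by (auto simp: eq_neg_iff_add_eq_0 simp flip: mult_2)
    ultimately show ?thesis using True by (simp add: e_def)
  next
    case 2: False
    have "{y\<in>Fq n. y^2 = c} = {}"
      using ye Fq_power_minus_1 2 False by fastforce
    then have "card {y\<in>Fq n. y^2 = c} = 0" by (simp only: card.empty)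
    then show ?thesis using 2 e by (simp add: e_def)
  qed
qed

end

section \<open>Counting points\<close>

text \<open>Raising to the power \<open>l\<close> is additive on polynomials, so
  \<open>c + X G\<close> becomes \<open>c^l + X^l G^l\<close>; induct on the coefficients.\<close>

lemma coeff_Frobenius_power:
  fixes G :: "'k::field poly"
  assumes "prime l" "CHAR('k) = l"
  shows "coeff (G ^ l) i = (if l dvd i then coeff G (i div l) ^ l else 0)"
proof (induction G arbitrary: i)
  case 0
  then show ?case using assms prime_gt_0_nat by (simp add: power_0_left)
next
  case (pCons c G)
  have l0: "l > 0" using assms prime_gt_0_nat by blast
  have "pCons c G ^ l = ([:c:] + monom 1 1 * G) ^ l"
    by (simp add: monom_altdef)
  also have "\<dots> = [:c:] ^ l + (monom 1 1 * G) ^ l"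
    by (rule freshmans_dream) (simp_all add: assms)
  also have "\<dots> = [:c ^ l:] + monom 1 l * G ^ l"
    by (simp add: power_mult_distrib monom_power poly_const_pow)
  finally have *: "coeff (pCons c G ^ l) i =
      coeff [:c ^ l:] i + (if i < l then 0 else coeff (G ^ l) (i - l))"
    by (simp add: coeff_monom_mult)
  show ?case
  proof (cases "i < l")
    case True
    then show ?thesis unfolding * using l0
      by (cases "i = 0") (auto simp: coeff_pCons split: nat.splits dest: dvd_imp_le)
  next
    case False
    then have "i > 0" "(l dvd i - l) = (l dvd i)" "i div l = Suc ((i - l) div l)"
      using l0 by (auto simp: dvd_minus_self le_div_geq)
    then show ?thesis unfolding * using False
      by (simp add: pCons.IH coeff_pCons split: nat.splits)
  qed
qed

locale elliptic_curve_over_prime_field = alg_closed_field_pchar K l + elliptic_curve a b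
  for K :: "'k::field itself" and l :: nat and a b :: 'k +
  assumes coeffs: "a \<in> Fq 1" "b \<in> Fq 1" and l_gt_3: "l > 3"
begin

lemma infinite_on: "infinite {P. on P}"
proof
  assume fin: "finite {P. on P}"
  have "range (\<lambda>x. Pt x (SOME y. y^2 = x^3 + a*x + b)) \<subseteq> {P. on P}"
    using someI_ex[OF sqrt_exists] by auto
  then have "finite (UNIV :: 'k set)"
    using fin by (metis (mono_tags, lifting) ec_point.inject finite_subset finite_imageD injI)
  then have "card (Fq n) \<le> card (UNIV :: 'k set)" for n
    by (simp add: card_mono)
  \<comment> \<open>With the exponent equal to the supposed size \<open>c\<close> of the field, the
    count gives \<open>l^c <= c\<close>.\<close>
  from this[of "card (UNIV :: 'k set)"]
  have "l ^ card (UNIV :: 'k set) \<le> card (UNIV :: 'k set)"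
    using finite_card_Fq[of "card (UNIV :: 'k set)"] \<open>finite UNIV\<close> by (simp add: card_gt_0_iff)
  then show False using power_gt_expt[of l "card (UNIV :: 'k set)"] l_gt_1 by simp
qed

section \<open>The groups of points over the finite subfields\<close>

definition rational :: "nat \<Rightarrow> 'k ec_point \<Rightarrow> bool" where
  "rational n P = (case P of Inf \<Rightarrow> True | Pt x y \<Rightarrow> x \<in> Fq n \<and> y \<in> Fq n)"

text \<open>The group of points over the field with \<open>l^n\<close> elements, packaged as a
  monoid record so that Sylow's theorem applies.\<close>

definition EG :: "nat \<Rightarrow> 'k ec_point monoid" where
  "EG n = \<lparr>carrier = {P. on P \<and> rational n P}, monoid.mult = ec_add a, one = Inf\<rparr>"

lemma rational_simps [simp]:
  "rational n Inf" "rational n (Pt x y) \<longleftrightarrow> x \<in> Fq n \<and> y \<in> Fq n"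
  by (simp_all add: rational_def)

lemma coeffs_Fq: "a \<in> Fq n" "b \<in> Fq n" using coeffs Fq_mono by auto

lemma rational_neg: "rational n P \<Longrightarrow> rational n (ec_neg P)"
  by (cases P) auto

lemma rational_add:
  assumes "rational n P" "rational n Q" shows "rational n (P \<oplus>\<^sub>E Q)"
proof (cases P; cases Q)
  fix x1 y1 x2 y2 assume *: "P = Pt x1 y1" "Q = Pt x2 y2"
  define m where "m = (if x1 = x2 then (3 * x1^2 + a) / (2 * y1) else (y2 - y1) / (x2 - x1))"
  have F: "x1 \<in> Fq n" "x2 \<in> Fq n" "y1 \<in> Fq n" "y2 \<in> Fq n" using assms * by auto
  then have m: "m \<in> Fq n"
    unfolding m_def using coeffs_Fq
    by (auto intro!: Fq_divide Fq_add Fq_mult Fq_power Fq_diff)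
  show ?thesis
  proof (cases "x1 = x2 \<and> y1 = - y2")
    case False
    then have "P \<oplus>\<^sub>E Q = Pt (m^2 - x1 - x2) (m * (x1 - (m^2 - x1 - x2)) - y1)"
      using * by (simp add: m_def Let_def)
    moreover have "m^2 - x1 - x2 \<in> Fq n" "m * (x1 - (m^2 - x1 - x2)) - y1 \<in> Fq n"
      using F m by (auto intro!: Fq_diff Fq_mult Fq_power)
    ultimately show ?thesis by simp
  qed (use * in auto)
qed (use assms in auto)

text \<open>Associativity is inherited from the curve over the algebraically closed field, which has
  the infinitely many points needed for general position.\<close>

lemma comm_group_EG: "comm_group (EG n)"
proof (rule comm_groupI)
  fix P Q R assume "P \<in> carrier (EG n)" "Q \<in> carrier (EG n)" "R \<in> carrier (EG n)"
  then show "P \<otimes>\<^bsub>EG n\<^esub> Q \<otimes>\<^bsub>EG n\<^esub> R = P \<otimes>\<^bsub>EG n\<^esub> (Q \<otimes>\<^bsub>EG n\<^esub> R)"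
    using add_assoc[OF infinite_on] by (simp add: EG_def)
next
  fix P assume P: "P \<in> carrier (EG n)"
  show "\<exists>Q\<in>carrier (EG n). Q \<otimes>\<^bsub>EG n\<^esub> P = \<one>\<^bsub>EG n\<^esub>"
    by (rule bexI[of _ "ec_neg P"])
      (use P add_commute[of "ec_neg P" P] in \<open>auto simp: EG_def rational_neg\<close>)
qed (auto simp: EG_def rational_add add_commute)

lemma carrier_EG: "carrier (EG n) = {P. on P \<and> rational n P}" by (simp add: EG_def)

lemma nat_pow_EG:
  assumes "P \<in> carrier (EG n)" shows "P [^]\<^bsub>EG n\<^esub> (m::nat) = ec_mult a m P"
proof -
  interpret comm_group "EG n" by (rule comm_group_EG)
  show ?thesis
  proof (induction m)
    case 0
    then show ?case by (simp add: EG_def)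
  next
    case (Suc m)
    have "P [^]\<^bsub>EG n\<^esub> Suc m = P \<otimes>\<^bsub>EG n\<^esub> P [^]\<^bsub>EG n\<^esub> m"
      using assms by (rule nat_pow_Suc2)
    then show ?case using Suc by (simp add: EG_def)
  qed
qed

lemma carrier_EG_eq:
  "carrier (EG n) = insert Inf ((\<lambda>(x, y). Pt x y) ` (SIGMA x:Fq n. {y\<in>Fq n. y^2 = x^3 + a*x + b}))"
proof (intro equalityI subsetI)
  fix P assume "P \<in> carrier (EG n)"
  then show "P \<in> insert Inf ((\<lambda>(x, y). Pt x y) ` (SIGMA x:Fq n. {y\<in>Fq n. y^2 = x^3 + a*x + b}))"
    by (cases P) (auto simp: carrier_EG image_iff)
qed (auto simp: carrier_EG)

lemma card_carrier_EG:
  assumes "n > 0"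
  shows "finite (carrier (EG n))"
    and "card (carrier (EG n)) = Suc (\<Sum>x\<in>Fq n. card {y\<in>Fq n. y^2 = x^3 + a*x + b})"
proof -
  note fin = finite_card_Fq[OF assms]
  let ?S = "SIGMA x:Fq n. {y\<in>Fq n. y^2 = x^3 + a*x + b}"
  have S: "finite ?S" using fin by (intro finite_SigmaI) auto
  then show "finite (carrier (EG n))" unfolding carrier_EG_eq by blast
  have "inj_on (\<lambda>(x, y). Pt x y) ?S" by (auto simp: inj_on_def)
  then have "card ((\<lambda>(x, y). Pt x y) ` ?S) = card ?S" by (rule card_image)
  also have "\<dots> = (\<Sum>x\<in>Fq n. card {y\<in>Fq n. y^2 = x^3 + a*x + b})"
    using fin by (subst card_SigmaI) auto
  finally show "card (carrier (EG n)) = Suc (\<Sum>x\<in>Fq n. card {y\<in>Fq n. y^2 = x^3 + a*x + b})"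
    unfolding carrier_EG_eq using S by (subst card_insert_disjoint) auto
qed

text \<open>Cauchy's theorem: Sylow's theorem for the exponent 1 yields a subgroup of order
  \<open>p\<close>, all of whose elements are killed by \<open>p\<close>.\<close>

lemma torsion_point_exists:
  assumes "n > 0" "prime p" "p dvd card (carrier (EG n))"
  shows "\<exists>P\<in>carrier (EG n). P \<noteq> Inf \<and> ec_mult a p P = Inf"
proof -
  interpret comm_group "EG n" by (rule comm_group_EG)
  obtain m where "Coset.order (EG n) = p^1 * m" using assms(3) by (auto simp: Coset.order_def)
  then obtain H where H: "subgroup H (EG n)" "card H = p"
    using sylow_thm[OF assms(2) is_group] card_carrier_EG(1)[OF assms(1)] by fastforce
  have fin: "finite H" using H(2) assms(2) prime_gt_0_nat card_ge_0_finite by metis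
  have "\<not> H \<subseteq> {Inf}"
    using card_mono[of "{Inf}" H] H(2) prime_gt_1_nat[OF assms(2)] by auto
  then obtain P where P: "P \<in> H" "P \<noteq> Inf" by auto
  then have PG: "P \<in> carrier (EG n)" using H(1) subgroup.mem_carrier by fastforce
  interpret H: group "EG n\<lparr>carrier := H\<rparr>" using H(1) by (rule subgroup_imp_group)
  have "P [^]\<^bsub>EG n\<lparr>carrier := H\<rparr>\<^esub> p = \<one>\<^bsub>EG n\<lparr>carrier := H\<rparr>\<^esub>"
    using H.pow_order_eq_1[of P] P H(2) by (simp add: Coset.order_def)
  then have "P [^]\<^bsub>EG n\<^esub> p = \<one>\<^bsub>EG n\<^esub>"
    using nat_pow_consistent by simp
  then have "ec_mult a p P = Inf" using nat_pow_EG[OF PG] by (simp add: EG_def)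
  then show ?thesis using PG P by blast
qed

section \<open>The Hasse invariant and point counts modulo l\<close>

definition cubic :: "'k poly" where "cubic = [:b, a, 0, 1:]"

text \<open>For \<open>n = 1\<close> this is the Hasse invariant; for general \<open>n\<close> it is
  its analogue for \<open>q = l^n\<close>, the trace of the \<open>q\<close>-Frobenius modulo
  \<open>l\<close>.\<close>

definition hasse :: "nat \<Rightarrow> 'k" where
  "hasse n = coeff (cubic ^ ((l^n - 1) div 2)) (l^n - 1)"

lemma poly_cubic [simp]: "poly cubic x = x^3 + a*x + b"
  by (simp add: cubic_def algebra_simps power3_eq_cube)

lemma degree_cubic_power [simp]: "degree (cubic ^ m) = 3 * m"
proof -
  have "cubic \<noteq> 0" "degree cubic = 3" by (auto simp: cubic_def)
  then show ?thesis by (simp add: degree_power_eq)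
qed

lemma l_ne_2: "l \<noteq> 2" using l_gt_3 by simp

text \<open>Sum Euler's criterion over all abscissae. Since \<open>f^((q-1)/2)\<close> has degree
  \<open>3(q-1)/2 < 2(q-1)\<close>, only its coefficient at \<open>X^(q-1)\<close> contributes to
  the power sums.\<close>

lemma of_nat_card_EG:
  assumes "n > 0" shows "of_nat (card (carrier (EG n))) = 1 - hasse n"
proof -
  have "of_nat (card (carrier (EG n))) =
      1 + (\<Sum>x\<in>Fq n. of_nat (card {y\<in>Fq n. y^2 = x^3 + a*x + b}) :: 'k)"
    using card_carrier_EG(2)[OF assms] by simp
  also have "(\<Sum>x\<in>Fq n. of_nat (card {y\<in>Fq n. y^2 = x^3 + a*x + b}) :: 'k) =
      (\<Sum>x\<in>Fq n. 1 + poly (cubic ^ ((l^n - 1) div 2)) x)"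
  proof (rule sum.cong)
    fix x assume "x \<in> Fq n"
    then have "x^3 + a*x + b \<in> Fq n" using coeffs_Fq by (intro Fq_add Fq_mult Fq_power)
    then show "of_nat (card {y\<in>Fq n. y^2 = x^3 + a*x + b}) = 1 + poly (cubic ^ ((l^n - 1) div 2)) x"
      using card_sqrt_Fq[OF assms l_ne_2] by (simp add: poly_power)
  qed simp
  also have "\<dots> = of_nat (l^n) + (\<Sum>x\<in>Fq n. poly (cubic ^ ((l^n - 1) div 2)) x)"
    using finite_card_Fq[OF assms] by (simp add: sum.distrib)
  also have "(\<Sum>x\<in>Fq n. poly (cubic ^ ((l^n - 1) div 2)) x) = - hasse n"
    unfolding hasse_def
    by (rule sum_poly_Fq) (use assms l_ne_2 q_gt_1[OF assms] in auto)
  finally show ?thesis using assms by simp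
qed

text \<open>The exponent splits as \<open>(l-1)/2 + l * (l^n-1)/2\<close>, so the power of the cubic
  is \<open>h * G^l\<close>, and \<open>G^l\<close> has only exponents divisible by
  \<open>l\<close>. A contributing exponent \<open>i\<close> of \<open>h\<close> is therefore
  \<open>l - 1\<close> modulo \<open>l\<close>, and \<open>i < 2l - 1\<close> leaves
  \<open>i = l - 1\<close> alone.\<close>

lemma hasse_Suc:
  assumes "n > 0" shows "hasse (Suc n) = hasse 1 * hasse n ^ l"
proof -
  let ?N = "l ^ Suc n - 1"
  let ?h = "cubic ^ ((l - 1) div 2)" and ?G = "cubic ^ ((l^n - 1) div 2)"
  have q: "l^n > 1" using q_gt_1[OF assms] .
  have "odd l" "odd (l^n)" using odd_l[OF l_ne_2, of 1] odd_l[OF l_ne_2] by auto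
  then obtain s t where s: "l = 2*s+1" and t: "l^n = 2*t+1" by (meson oddE)
  have "l ^ Suc n = (2*s+1) * (2*t+1)" using s t by simp
  then have half: "?N div 2 = (l - 1) div 2 + (l^n - 1) div 2 * l"
    using s t by (simp add: algebra_simps)
  have N: "?N = (l - 1) + l * (l^n - 1)" using q l_gt_1 by (simp add: algebra_simps)
  have "hasse (Suc n) = coeff (?h * ?G ^ l) ?N"
    unfolding hasse_def half power_add power_mult by simp
  also have "\<dots> = (\<Sum>i\<le>?N. coeff ?h i * coeff (?G ^ l) (?N - i))"
    by (simp add: coeff_mult)
  also have "\<dots> = (\<Sum>i\<in>{l - 1}. coeff ?h i * coeff (?G ^ l) (?N - i))"
  proof (rule sum.mono_neutral_right)
    show "\<forall>i\<in>{..?N} - {l - 1}. coeff ?h i * coeff (?G ^ l) (?N - i) = 0"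
    proof
      fix i assume i: "i \<in> {..?N} - {l - 1}"
      show "coeff ?h i * coeff (?G ^ l) (?N - i) = 0"
      proof (cases "i \<le> 3 * ((l - 1) div 2) \<and> l dvd ?N - i")
        case True
        then obtain c where c: "?N - i = l * c" by blast
        then have "i + l * c = (l - 1) + l * (l^n - 1)" using i N by auto
        then have "i mod l = (l - 1) mod l" by (metis mod_mult_self2)
        then have "i mod l = l - 1" using l_gt_1 by simp
        moreover have "i < 2 * l - 1" using True s l_gt_1 by auto
        ultimately have "i = l - 1"
          using l_gt_1 by (cases "i < l") (auto simp: mod_if split: if_splits)
        then show ?thesis using i by simp
      next
        case False
        then show ?thesis
          using coeff_eq_0[of ?h i] coeff_Frobenius_power[OF prime_l CHAR_eq, of ?G] by auto
      qed
    qed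
  qed (use N in auto)
  also have "\<dots> = coeff ?h (l - 1) * coeff (?G ^ l) (l * (l^n - 1))" using N by simp
  also have "coeff (?G ^ l) (l * (l^n - 1)) = coeff ?G (l^n - 1) ^ l"
    using coeff_Frobenius_power[OF prime_l CHAR_eq, of ?G] l_gt_1 by simp
  finally show ?thesis by (simp add: hasse_def)
qed

lemma hasse_1_Fq: "hasse 1 \<in> Fq 1"
proof -
  have "hasse 1 = 1 - of_nat (card (carrier (EG 1)))" using of_nat_card_EG[of 1] by simp
  then show ?thesis by (metis Fq_1 Fq_diff Fq_of_nat)
qed

lemma hasse_power: "n > 0 \<Longrightarrow> hasse n = hasse 1 ^ n"
proof (induction n rule: nat_induct_non_zero)
  case (Suc n)
  have "(hasse 1 ^ n) ^ l = hasse 1 ^ n"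
    using Fq_power[OF hasse_1_Fq, of n] by (simp add: Fq_def)
  then show ?case using Suc hasse_Suc by simp
qed simp

lemma supersingular_imp_hasse_0:
  assumes "supersingular_curve l a b" shows "hasse 1 = 0"
proof (rule ccontr)
  assume "hasse 1 \<noteq> 0"
  \<comment> \<open>Fermat's little theorem, as \<open>hasse 1\<close> is a nonzero element of the
    prime field.\<close>
  then have "hasse (l - 1) = 1"
    using Fq_power_minus_1[OF hasse_1_Fq] hasse_power[of "l - 1"] l_gt_1 by simp
  then have "of_nat (card (carrier (EG (l - 1)))) = (0::'k)"
    using of_nat_card_EG[of "l - 1"] l_gt_1 by simp
  then have "l dvd card (carrier (EG (l - 1)))"
    using of_nat_eq_0_iff_char_dvd CHAR_eq by metis
  from torsion_point_exists[OF _ prime_l this] l_gt_1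
  obtain P where "P \<in> carrier (EG (l - 1))" "P \<noteq> Inf" "ec_mult a l P = Inf" by auto
  then show False using assms by (auto simp: supersingular_curve_def carrier_EG)
qed

end

section \<open>Supersingular curves and their 5-torsion\<close>

context elliptic_curve_over_prime_field
begin

lemma poly_eq_0_if_zero_on_Fq:
  fixes p :: "'k poly"
  assumes "degree p < l" "\<And>x. x \<in> Fq 1 \<Longrightarrow> poly p x = 0"
  shows "p = 0"
proof (rule ccontr)
  assume p: "p \<noteq> 0"
  have "card (Fq 1) \<le> card {x. poly p x = 0}"
    using assms(2) poly_roots_finite[OF p] by (intro card_mono) auto
  also have "\<dots> \<le> degree p" using card_poly_roots_bound[OF p] .
  finally show False using assms(1) finite_card_Fq[of 1] by simp
qed

text \<open>If \<open>f\<^sup>m - e\<close> with \<open>m = (l - 1) / 2\<close> vanished on the prime field, it would be \<open>(x\<^sup>l - x) u\<close>;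
  differentiating gives \<open>2 f u = e f'\<close> on the prime field and hence, by degrees, identically.\<close>

lemma cubic_power_not_constant:
  "\<not> (\<forall>x\<in>Fq 1. poly cubic x ^ ((l - 1) div 2) = e)"
proof
  assume const: "\<forall>x\<in>Fq 1. poly cubic x ^ ((l - 1) div 2) = e"
  define m where "m = (l - 1) div 2"
  have "odd l" using odd_l[OF l_ne_2, of 1] by simp
  then have l: "l = 2 * m + 1" using l_gt_1 by (auto simp: m_def elim!: oddE)
  define X :: "'k poly" where "X = monom 1 l - [:0, 1:]"
  have "degree [:0, 1 :: 'k:] < degree (monom (1::'k) l)"
    using l_gt_1 by (simp add: degree_monom_eq)
  then have degX: "degree X = l"
    unfolding X_def using degree_add_eq_left[of "- [:0, 1:]" "monom (1::'k) l"]
    unfolding diff_conv_add_uminus degree_minus by (metis degree_monom_eq one_neq_zero)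
  then have X0: "X \<noteq> 0" using l_gt_1 by (metis degree_0 not_one_less_zero)
  have polyX: "poly X x = 0" if "x \<in> Fq 1" for x
    using that by (simp add: X_def Fq_def poly_monom)
  have dX: "pderiv X = [:-1:]"
    by (simp add: X_def pderiv_diff pderiv_monom pderiv_pCons)
  define g where "g = cubic ^ m - [:e:]"
  have gX: "poly g x = 0" if "x \<in> Fq 1" for x
    using const that by (simp add: g_def poly_power m_def)
  have degg: "degree g = 3 * m"
  proof -
    have "degree (- [:e:]) < degree (cubic ^ m)" using l l_gt_3 by simp
    from degree_add_eq_left[OF this] show ?thesis
      unfolding g_def diff_conv_add_uminus by (metis degree_cubic_power)
  qed
  have "g mod X = 0"
  proof (rule poly_eq_0_if_zero_on_Fq)
    show "degree (g mod X) < l" using degree_mod_less[OF X0, of g] degX l_gt_1 by auto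
    fix x assume x: "x \<in> Fq 1"
    have "poly g x = poly (g div X) x * poly X x + poly (g mod X) x"
      by (metis div_mult_mod_eq poly_add poly_mult)
    then show "poly (g mod X) x = 0" using gX[OF x] polyX[OF x] by simp
  qed
  then obtain u where u: "g = X * u" by (metis mod_eq_0_iff_dvd dvdE)
  have "g \<noteq> 0" using degg l l_gt_3 by auto
  then have u0: "u \<noteq> 0" using u by auto
  have degu: "degree u + l = 3 * m"
    using degg u X0 u0 degX by (simp add: degree_mult_eq)
  have pw: "cubic * pderiv (cubic ^ m) = smult (of_nat m) (cubic ^ m * pderiv cubic)"
  proof -
    obtain k where k: "m = Suc k" using l l_gt_3 by (cases m) auto
    show ?thesis unfolding k pderiv_power_Suc by (simp add: mult_ac)
  qed
  have "of_nat l = (2 * of_nat m + 1 :: 'k)" unfolding l by simp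
  then have 2: "2 * of_nat m = (- 1 :: 'k)" by (simp add: eq_neg_iff_add_eq_0)
  define w where "w = smult 2 (cubic * u) - smult e (pderiv cubic)"
  have "w = 0"
  proof (rule poly_eq_0_if_zero_on_Fq)
    fix x assume x: "x \<in> Fq 1"
    have "pderiv (cubic ^ m) = pderiv g" by (simp add: g_def pderiv_diff pderiv_pCons)
    also have "\<dots> = - u + X * pderiv u" unfolding u pderiv_mult dX by (simp add: mult.commute)
    finally have "poly (pderiv (cubic ^ m)) x = - poly u x"
      using polyX[OF x] by simp
    moreover have "poly cubic x * poly (pderiv (cubic ^ m)) x = of_nat m * (e * poly (pderiv cubic) x)"
      using arg_cong[OF pw, of "\<lambda>p. poly p x"] const x by (simp add: poly_power m_def del: poly_cubic)
    ultimately have h: "- (poly cubic x * poly u x) = of_nat m * (e * poly (pderiv cubic) x)"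
      by (simp del: poly_cubic)
    have "2 * (poly cubic x * poly u x) = - (2 * (- (poly cubic x * poly u x)))"
      by (simp del: poly_cubic)
    also have "\<dots> = - (2 * of_nat m) * (e * poly (pderiv cubic) x)"
      unfolding h by (simp add: mult.assoc del: poly_cubic)
    finally have "2 * (poly cubic x * poly u x) = - (2 * of_nat m) * (e * poly (pderiv cubic) x)" .
    then show "poly w x = 0" unfolding 2 by (simp add: w_def del: poly_cubic)
  next
    have "degree cubic = 3" by (simp add: cubic_def)
    then have "degree (cubic * u) \<le> 3 + degree u" using degree_mult_le[of cubic u] by simp
    moreover have "degree (pderiv cubic) \<le> 3"
      using degree_pderiv_le[of cubic] \<open>degree cubic = 3\<close> by simp
    ultimately have "degree w \<le> 3 + degree u"
      unfolding w_def by (intro degree_diff_le) (auto intro: order.trans[OF degree_smult_le])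
    \<comment> \<open>Here \<open>degree u = m - 1\<close>, so the bound is \<open>m + 2\<close>,
      which is below \<open>l = 2m + 1\<close> because \<open>m >= 2\<close>.\<close>
    then show "degree w < l" using degu l l_gt_3 by simp
  qed
  then have "smult 2 (cubic * u) = smult e (pderiv cubic)" by (simp add: w_def)
  \<comment> \<open>The identity \<open>2 f u = e f'\<close> is now refuted by degrees: at least 3
    on the left, at most 2 on the right.\<close>
  moreover have "degree (smult 2 (cubic * u)) \<ge> 3"
  proof -
    have "cubic \<noteq> 0" "degree cubic = 3" by (auto simp: cubic_def)
    then show ?thesis using two_nonzero u0 by (simp add: degree_mult_eq)
  qed
  moreover have "degree (smult e (pderiv cubic)) \<le> 2"
    using degree_smult_le[of e "pderiv cubic"] by (simp add: cubic_def pderiv_pCons split: if_splits)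
  ultimately show False by simp
qed

text \<open>An elementary substitute for the Hasse bound. Each fibre has at most two points, so the
  number \<open>M\<close> of affine points is a multiple of \<open>l\<close> between
  \<open>0\<close> and \<open>2l\<close>. At either end all fibres have the same size, so Euler's
  criterion makes the power of the cubic constant.\<close>

lemma card_EG_supersingular:
  assumes "hasse 1 = 0" shows "card (carrier (EG 1)) = l + 1"
proof -
  define c where "c = (\<lambda>x. card {y\<in>Fq 1. y^2 = x^3 + a*x + b})"
  define M where "M = (\<Sum>x\<in>Fq 1. c x)"
  have fin: "finite (Fq 1)" "card (Fq 1) = l" using finite_card_Fq[of 1] by auto
  have N: "card (carrier (EG 1)) = Suc M"
    using card_carrier_EG(2)[of 1] by (simp add: M_def c_def)
  have ck: "of_nat (c x) = 1 + poly cubic x ^ ((l - 1) div 2)" if "x \<in> Fq 1" for x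
  proof -
    have "x^3 + a*x + b \<in> Fq 1" using that coeffs by (intro Fq_add Fq_mult Fq_power)
    then show ?thesis using card_sqrt_Fq[of 1] l_ne_2 by (simp add: c_def)
  qed
  have c2: "c x \<le> 2" for x
  proof -
    have "{y\<in>Fq 1. y^2 = x^3 + a*x + b} \<subseteq> {y. poly [:-(x^3 + a*x + b), 0, 1:] y = 0}"
      by (auto simp: power2_eq_square)
    then have "c x \<le> card {y. poly [:-(x^3 + a*x + b), 0, 1:] y = 0}"
      unfolding c_def by (intro card_mono poly_roots_finite) auto
    also have "\<dots> \<le> degree [:-(x^3 + a*x + b), 0, 1:]" by (rule card_poly_roots_bound) simp
    finally show ?thesis by simp
  qed
  have "of_nat M = (0::'k)"
    using of_nat_card_EG[of 1] N assms by simp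
  then have "l dvd M" using of_nat_eq_0_iff_char_dvd CHAR_eq by metis
  then obtain k where k: "M = l * k" by blast
  have "M \<le> (\<Sum>x\<in>Fq 1. 2)" unfolding M_def by (intro sum_mono c2)
  then have "M \<le> l * 2" using fin by simp
  then have "k \<le> 2" using k l_gt_1 by simp
  moreover have "k \<noteq> 0"
  proof
    assume "k = 0"
    then have "c x = 0" if "x \<in> Fq 1" for x using k that fin by (auto simp: M_def)
    then have "\<forall>x\<in>Fq 1. poly cubic x ^ ((l - 1) div 2) = - 1"
      using ck by (simp add: eq_neg_iff_add_eq_0 add.commute del: poly_cubic)
    then show False using cubic_power_not_constant by blast
  qed
  moreover have "k \<noteq> 2"
  proof
    assume "k = 2"
    have "c x = 2" if x: "x \<in> Fq 1" for x
    proof (rule ccontr)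
      assume "c x \<noteq> 2"
      then have "c x < 2" using c2[of x] by simp
      then have "M < (\<Sum>x\<in>Fq 1. 2)"
        unfolding M_def using fin x c2 by (intro sum_strict_mono_ex1) auto
      then show False using k \<open>k = 2\<close> fin by simp
    qed
    then have "\<forall>x\<in>Fq 1. poly cubic x ^ ((l - 1) div 2) = 1"
      using ck by (auto simp del: poly_cubic)
    then show False using cubic_power_not_constant by blast
  qed
  ultimately have "k = 1" by simp
  then show ?thesis using N k by simp
qed

text \<open>\<open>M\<close> is the sum of the slopes of the tangent at \<open>P\<close> and of the line through \<open>P\<close> and \<open>2P\<close>, which
  is tangent at \<open>2P\<close>; \<open>t\<close> is the parameter of the Tate normal form.\<close>

lemma five_torsion_param:
  assumes P: "on P" "rational 1 P" "P \<noteq> Inf" "ec_mult a 5 P = Inf"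
  obtains t M where "t \<in> Fq 1" "M \<noteq> 0" "t \<noteq> 0"
    "48 * a = - (M^4 * (t^4 - 12*t^3 + 14*t^2 + 12*t + 1))"
    "864 * b = M^6 * ((t^2 + 1) * (t^4 - 18*t^3 + 74*t^2 + 18*t + 1))"
proof -
  define D T where "D = P \<oplus>\<^sub>E P" and "T = P \<oplus>\<^sub>E D"
  have on: "on D" "on T" using P by (simp_all add: D_def T_def)
  have "P \<oplus>\<^sub>E (P \<oplus>\<^sub>E T) = Inf"
    using P(4) by (simp add: D_def T_def eval_nat_numeral)
  then have "T \<oplus>\<^sub>E D = Inf"
    using add_assoc[OF infinite_on P(1) P(1) on(2)] add_commute on by (simp add: D_def)
  \<comment> \<open>The torsion condition in the form \<open>3P = - 2P\<close>.\<close>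
  then have T: "T = ec_neg D" using add_neg_cancel[OF on(2,1)] by simp
  have DInf: "D \<noteq> Inf" using T P(3) by (auto simp: T_def)
  obtain x1 y1 x2 y2 where P1: "P = Pt x1 y1" and D2: "D = Pt x2 y2"
    using DInf P(3) by (metis ec_point.exhaust)
  have y1: "\<not> (x1 = x1 \<and> y1 = - y1)" using DInf P1 by (auto simp: D_def)
  then have "y1 \<noteq> 0" by auto
  obtain m where m: "y1 - y1 = m * (x1 - x1)" "m * (y1 + y1) = x1^2 + x1*x1 + x1^2 + a"
    using slope_exists y1 P P1 by metis
  have x2: "x2 = m^2 - x1 - x1" and y2: "y2 = m * (x1 - x2) - y1"
    using add_slope[OF y1 m] P1 D2 D_def by auto
  have neq: "x1 \<noteq> x2"
  proof
    assume eq: "x1 = x2"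
    then have "y2 = - y1" using y2 by simp
    then have "D = ec_neg P" using P1 D2 eq by simp
    then have "T = Inf" by (simp add: T_def)
    then show False using T D2 by simp
  qed
  define d \<mu> where "d = x2 - x1" and "\<mu> = (y2 - y1) / (x2 - x1)"
  have d0: "d \<noteq> 0" using neq by (simp add: d_def)
  have \<mu>d: "\<mu> * d = y2 - y1" using neq by (simp add: d_def \<mu>_def)
  have "T = Pt (\<mu>^2 - x1 - x2) (\<mu> * (x1 - (\<mu>^2 - x1 - x2)) - y1)"
    using neq by (simp add: T_def P1 D2 \<mu>_def Let_def)
  \<comment> \<open>The points \<open>3P\<close> and \<open>2P\<close> have the same
    abscissa.\<close>
  then have \<mu>2: "\<mu>^2 = x1 + 2 * x2" using T D2 by (simp add: algebra_simps)
  define M t where "M = \<mu> + m" and "t = d / M^2"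
  have "M * d = \<mu> * d + m * d" by (simp add: M_def algebra_simps)
  also have "\<dots> = - (2 * y1)" unfolding \<mu>d unfolding y2 d_def by (simp add: algebra_simps)
  finally have Md: "M * d = - (2 * y1)" .
  have M0: "M \<noteq> 0" using Md \<open>y1 \<noteq> 0\<close> two_nonzero by auto
  have d: "d = t * M^2" using M0 by (simp add: t_def)
  \<comment> \<open>From \<open>m^2 = 2 x1 + x2\<close> and \<open>\<mu>^2 = x1 + 2 x2\<close> the
    difference of squares is \<open>d = t M^2\<close>. Cancelling \<open>M\<close> expresses
    \<open>2 m\<close>, \<open>2 y1\<close> and \<open>12 x1\<close> as \<open>M\<close>,
    \<open>M^3\<close> and \<open>M^2\<close> times polynomials in \<open>t\<close>.\<close>
  have "(\<mu> - m) * M = \<mu>^2 - m^2" by (simp add: M_def algebra_simps power2_eq_square)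
  also have "\<dots> = d" unfolding \<mu>2 d_def x2 by (simp add: algebra_simps)
  also have "\<dots> = (t * M) * M" by (simp add: d power2_eq_square)
  finally have "\<mu> - m = t * M" using M0 by simp
  then have m2: "2 * m = (1 - t) * M" unfolding M_def by (simp add: algebra_simps)
  have Y: "2 * y1 = - (t * M^3)" using Md by (simp add: d power2_eq_square power3_eq_cube mult_ac)
  have X3: "3 * x1 = m^2 - d" unfolding d_def x2 by (simp add: algebra_simps)
  have "12 * x1 = 4 * (3 * x1)" by simp
  also have "\<dots> = (2 * m)^2 - 4 * d" unfolding X3 by (simp add: algebra_simps power2_eq_square)
  also have "\<dots> = (t^2 - 6*t + 1) * M^2" unfolding m2 d by Groebner_Basis.algebra
  finally have X: "12 * x1 = (t^2 - 6*t + 1) * M^2" .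
  have "48 * a = 24 * ((2 * m) * (2 * y1)) - (12 * x1)^2"
  proof -
    have a: "a = m * (y1 + y1) - x1^2 - x1*x1 - x1^2" using m(2) by simp
    show ?thesis unfolding a by Groebner_Basis.algebra
  qed
  also have "\<dots> = - (M^4 * (t^4 - 12*t^3 + 14*t^2 + 12*t + 1))"
    unfolding m2 Y X by Groebner_Basis.algebra
  finally have A: "48 * a = - (M^4 * (t^4 - 12*t^3 + 14*t^2 + 12*t + 1))" .
  have "2 * (864 * b) = 432 * (2 * y1)^2 - (12 * x1)^3 - 3 * (48 * a) * (12 * x1)"
  proof -
    have b: "b = y1^2 - x1^3 - a * x1" using P(1) P1 by simp
    show ?thesis unfolding b by Groebner_Basis.algebra
  qed
  also have "\<dots> = 2 * (M^6 * ((t^2 + 1) * (t^4 - 18*t^3 + 74*t^2 + 18*t + 1)))"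
    unfolding A X Y by Groebner_Basis.algebra
  finally have B: "864 * b = M^6 * ((t^2 + 1) * (t^4 - 18*t^3 + 74*t^2 + 18*t + 1))"
    unfolding mult_left_cancel[OF two_nonzero] .
  have x1F: "x1 \<in> Fq 1" "y1 \<in> Fq 1" using P(2) P1 by auto
  have x2F: "x2 \<in> Fq 1" "y2 \<in> Fq 1"
    using rational_add[OF P(2) P(2)] D2 by (auto simp: D_def)
  have "M = (- (2 * y1)) / d" using Md d0 by (simp add: field_simps)
  then have "t \<in> Fq 1"
    unfolding t_def using x1F x2F by (auto simp: d_def intro!: Fq_divide Fq_power Fq_diff)
  moreover have "t \<noteq> 0" using d0 M0 by (simp add: t_def)
  ultimately show thesis using that M0 A B by blast
qed

text \<open>In \<open>(X^3 + a X)^(2s)\<close> with \<open>l - 1 = 4s\<close>, the exponent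
  \<open>4s\<close> occurs only for \<open>k = s\<close>. Its coefficient is \<open>a^s\<close>
  times the central binomial coefficient, a unit because \<open>2s < l\<close>.\<close>

lemma hasse_j1728:
  assumes "b = 0" "a \<noteq> 0" "4 dvd l - 1" shows "hasse 1 \<noteq> 0"
proof -
  obtain s where s: "l - 1 = 4 * s" using assms(3) by blast
  then have m: "(l - 1) div 2 = 2 * s" by simp
  have cub: "cubic = monom 1 3 + monom a 1"
    unfolding cubic_def unfolding assms(1) by (simp add: monom_altdef eval_nat_numeral)
  have "cubic ^ (2 * s) = (\<Sum>k\<le>2*s. of_nat (2*s choose k) * monom 1 3 ^ k * monom a 1 ^ (2*s - k))"
    unfolding cub by (rule binomial_ring)
  also have "\<dots> = (\<Sum>k\<le>2*s. monom (of_nat (2*s choose k) * a ^ (2*s - k)) (3*k + (2*s - k)))"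
    by (rule sum.cong) (simp_all add: monom_power mult_monom of_nat_poly smult_monom)
  finally have "hasse 1 = (\<Sum>k\<le>2*s. coeff (monom (of_nat (2*s choose k) * a ^ (2*s - k)) (3*k + (2*s - k))) (4*s))"
    unfolding hasse_def power_one_right m unfolding s by (simp only: coeff_sum)
  also have "\<dots> = (\<Sum>k\<le>2*s. if k = s then of_nat (2*s choose s) * a ^ s else 0)"
  proof (rule sum.cong)
    fix k assume "k \<in> {..2*s}"
    then have "3*k + (2*s - k) = 4*s \<longleftrightarrow> k = s" by auto
    then show "coeff (monom (of_nat (2*s choose k) * a ^ (2*s - k)) (3*k + (2*s - k))) (4*s)
        = (if k = s then of_nat (2*s choose s) * a ^ s else 0)" by auto
  qed simp
  also have "\<dots> = of_nat (2*s choose s) * a ^ s" by simp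
  finally have h: "hasse 1 = of_nat (2*s choose s) * a ^ s" .
  have "\<not> l dvd fact (2*s)"
    using prime_dvd_fact_iff[OF prime_l] s l_gt_1 by simp
  then have "\<not> l dvd (2*s choose s)"
    using binomial_fact_lemma[of s "2*s"] by (metis dvd_mult le_add2 mult_2)
  then show ?thesis using h assms(2) of_nat_eq_0_iff_char_dvd[where 'a='k] CHAR_eq by simp
qed

lemma minus_1_square_imp: "t \<in> Fq 1 \<Longrightarrow> t^2 + 1 = 0 \<Longrightarrow> 4 dvd l - 1"
proof -
  assume t: "t \<in> Fq 1" "t^2 + 1 = 0"
  then have "t \<noteq> 0" by auto
  have "odd l" using odd_l[OF l_ne_2, of 1] by simp
  then obtain m where m: "l - 1 = 2 * m" using l_gt_1 by (auto elim!: oddE)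
  have "t ^ (2 * m) = 1" using Fq_power_minus_1[OF t(1) \<open>t \<noteq> 0\<close>] m by simp
  moreover have "t^2 = - 1" using t(2) by (simp add: eq_neg_iff_add_eq_0)
  ultimately have "(- 1) ^ m = (1::'k)" by (simp add: power_mult)
  moreover have "(- 1 :: 'k) \<noteq> 1" using two_nonzero by (simp add: neg_eq_iff_add_eq_0)
  ultimately have "even m" by (metis neg_one_odd_power)
  then show "4 dvd l - 1" using m by auto
qed

end

section \<open>The sextic of level 5\<close>

text \<open>Up to sign of the variable and the value, the covering from X_0(25) to X_0(5) in terms
  of their Hauptmoduln; \<open>quint_R\<close> uniformises it by a fifth power.\<close>

definition quint :: "'a::comm_ring_1 \<Rightarrow> 'a" where
  "quint p = p^5 - 5*p^4 + 15*p^3 - 25*p^2 + 25*p"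

text \<open>With \<open>D = R - 1/R\<close> the left side is \<open>D^5 + 5 D^3 + 5 D + 11\<close>,
  and the first three terms are the Lucas type expression of \<open>R^5 - 1/R^5\<close> in
  \<open>D\<close>.\<close>

lemma quint_R:
  fixes R :: "'a::field"
  assumes "R \<noteq> 0" shows "quint (R - 1/R + 1) = R^5 - 1/R^5 + 11"
proof -
  define i where "i = 1/R"
  have Ri: "R * i = 1" using assms by (simp add: i_def)
  have "quint (R - i + 1) = (R - i)^5 + 5 * (R - i)^3 + 5 * (R - i) + 11"
    unfolding quint_def by Groebner_Basis.algebra
  also have "(R - i)^5 = R^5 - i^5 - 5 * (R * i) * (R^3 - i^3) + 10 * (R * i)^2 * (R - i)"
    by Groebner_Basis.algebra
  also have "(R - i)^3 = R^3 - i^3 - 3 * (R * i) * (R - i)"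
    by Groebner_Basis.algebra
  finally have "quint (R - i + 1) = R^5 - i^5 + 11"
    unfolding Ri by (simp add: algebra_simps)
  then show ?thesis by (simp add: i_def power_one_over)
qed

text \<open>Two distinct points of one fibre of \<open>quint\<close>, described by symmetric
  functions: the first equation is the vanishing divided difference, the second the sum of the two
  values.\<close>

lemma quint_pair:
  fixes p P :: "'a::idom"
  assumes "quint p = B" "quint P = B" "p \<noteq> P" "s = p + P" "m = p * P"
  shows "s^4 - 3*s^2*m + m^2 - 5*(s^3 - 2*s*m) + 15*(s^2 - m) - 25*s + 25 = 0"
    and "2*B = s^5 - 5*s^3*m + 5*s*m^2 - 5*s^4 + 20*s^2*m - 10*m^2 + 15*s^3 - 45*s*m
      - 25*s^2 + 50*m + 25*s"
proof -
  have "(p - P) * (s^4 - 3*s^2*m + m^2 - 5*(s^3 - 2*s*m) + 15*(s^2 - m) - 25*s + 25)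
      = quint p - quint P"
    unfolding assms(4,5) quint_def by Groebner_Basis.algebra
  then show "s^4 - 3*s^2*m + m^2 - 5*(s^3 - 2*s*m) + 15*(s^2 - m) - 25*s + 25 = 0"
    using assms(1,2,3) by simp
  have "2*B = quint p + quint P" using assms(1,2) by simp
  also have "\<dots> = s^5 - 5*s^3*m + 5*s*m^2 - 5*s^4 + 20*s^2*m - 10*m^2 + 15*s^3 - 45*s*m
      - 25*s^2 + 50*m + 25*s"
    unfolding assms(4,5) quint_def by Groebner_Basis.algebra
  finally show "2*B = s^5 - 5*s^3*m + 5*s*m^2 - 5*s^4 + 20*s^2*m - 10*m^2 + 15*s^3 - 45*s*m
      - 25*s^2 + 50*m + 25*s" .
qed

text \<open>The three cases say that \<open>P/p\<close> is \<open>- 1\<close>, a primitive cube root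
  or a primitive sixth root of unity. Each leaves one free quantity, and eliminating it gives a
  quadratic for \<open>B\<close>; these values of \<open>B\<close> belong to \<open>j = 1728\<close>
  or \<open>j = 0\<close> by \<open>level5_special\<close>.\<close>

lemma quint_eq_and_power6_eq:
  fixes p P :: "'a::field"
  assumes "(2::'a) \<noteq> 0" "(3::'a) \<noteq> 0"
    and "quint p = B" "quint P = B" "p \<noteq> P" "p^6 = P^6"
  shows "B^2 - 250*B + 3125 = 0 \<or> B^2 + 500*B - 15625 = 0"
proof -
  define s m where "s = p + P" and "m = p * P"
  note Q = quint_pair[OF assms(3-5) s_def m_def]
  have "(p - P) * (s * ((s^2 - m) * (s^2 - 3*m))) = p^6 - P^6"
    unfolding s_def m_def by Groebner_Basis.algebra
  then consider "s = 0" | "m = s^2" | "s^2 = 3*m" using assms(5,6) by auto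
  then show ?thesis
  proof cases
    case 1
    have h: "m^2 - 15*m + 25 = 0" using Q(1) 1 by simp
    have "2*B = 2 * (- 50*m + 125) - 10 * (m^2 - 15*m + 25)"
      unfolding Q(2) 1 by (simp add: algebra_simps)
    then have "2*B = 2 * (- 50*m + 125)" unfolding h by simp
    then have B: "B = - 50*m + 125" unfolding mult_left_cancel[OF assms(1)] .
    have "B^2 + 500*B - 15625 = 2500 * (m^2 - 15*m + 25)"
      unfolding B by Groebner_Basis.algebra
    then show ?thesis unfolding h by simp
  next
    case 2
    have "s^4 - 5*s^3 + 25*s - 25 =
        - (s^4 - 3*s^2*m + m^2 - 5*(s^3 - 2*s*m) + 15*(s^2 - m) - 25*s + 25)"
      unfolding 2 by Groebner_Basis.algebra
    then have h: "s^4 - 5*s^3 + 25*s - 25 = 0" unfolding Q(1) by simp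
    have "2*B = 2 * (10*s^3 - 100*s + 125) + (s + 10) * (s^4 - 5*s^3 + 25*s - 25)"
      unfolding Q(2) 2 by Groebner_Basis.algebra
    then have "2*B = 2 * (10*s^3 - 100*s + 125)" unfolding h by simp
    then have B: "B = 10*s^3 - 100*s + 125" unfolding mult_left_cancel[OF assms(1)] .
    have "B^2 - 250*B + 3125 = 100 * (s^2 + 5*s + 5) * (s^4 - 5*s^3 + 25*s - 25)"
      unfolding B by Groebner_Basis.algebra
    then show ?thesis unfolding h by simp
  next
    case 3
    \<comment> \<open>This parametrises \<open>s^2 = 3 m\<close> by \<open>s = 3 c\<close>,
      \<open>m = 3 c^2\<close>.\<close>
    define c where "c = s / 3"
    have s: "s = 3*c" using assms(2) by (simp add: c_def)
    have "3 * m = 3 * (3*c^2)" using 3 unfolding s by (simp add: power2_eq_square)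
    then have m: "m = 3*c^2" unfolding mult_left_cancel[OF assms(2)] .
    have "9*c^4 - 45*c^3 + 90*c^2 - 75*c + 25 =
        s^4 - 3*s^2*m + m^2 - 5*(s^3 - 2*s*m) + 15*(s^2 - m) - 25*s + 25"
      unfolding s m by Groebner_Basis.algebra
    then have h: "9*c^4 - 45*c^3 + 90*c^2 - 75*c + 25 = 0" unfolding Q(1) .
    have "2*B = 2 * (- 90*c^3 + 300*c^2 - 300*c + 125)
        + (- 3*c - 10) * (9*c^4 - 45*c^3 + 90*c^2 - 75*c + 25)"
      unfolding Q(2) s m by Groebner_Basis.algebra
    then have "2*B = 2 * (- 90*c^3 + 300*c^2 - 300*c + 125)" unfolding h by simp
    then have B: "B = - 90*c^3 + 300*c^2 - 300*c + 125" unfolding mult_left_cancel[OF assms(1)] .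
    have "B^2 - 250*B + 3125 =
        (900*c^2 - 1500*c - 500) * (9*c^4 - 45*c^3 + 90*c^2 - 75*c + 25)"
      unfolding B by Groebner_Basis.algebra
    then show ?thesis unfolding h by simp
  qed
qed

text \<open>The condition \<open>p^6 = 125\<close> means that the transferred root
  \<open>p^6/B\<close> coincides with \<open>125/B\<close>; this too happens only for the
  exceptional \<open>B\<close>.\<close>

lemma quint_and_power6_125:
  fixes p :: "'a::field"
  assumes "quint p = B" "p^6 = 125"
  shows "B^2 - 250*B + 3125 = 0 \<or> B^2 + 500*B - 15625 = 0"
proof -
  have "(p^2 - 5) * (p^4 + 5*p^2 + 25) = p^6 - 125" by Groebner_Basis.algebra
  then consider "p^2 - 5 = 0" | "p^4 + 5*p^2 + 25 = 0" using assms(2) by auto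
  then show ?thesis
  proof cases
    case 1
    have "B = 125*p - 250 + (p^2 - 5) * (p^3 - 5*p^2 + 20*p - 50)"
      unfolding assms(1)[symmetric] quint_def by Groebner_Basis.algebra
    then have B: "B = 125*p - 250" unfolding 1 by simp
    have "B^2 + 500*B - 15625 = 15625 * (p^2 - 5)" unfolding B by Groebner_Basis.algebra
    then show ?thesis unfolding 1 by simp
  next
    case 2
    have "B = 10*p^3 + 125 + (p^4 + 5*p^2 + 25) * (p - 5)"
      unfolding assms(1)[symmetric] quint_def by Groebner_Basis.algebra
    then have B: "B = 10*p^3 + 125" unfolding 2 by simp
    have "B^2 - 250*B + 3125 = 100 * (p^6 - 125)" unfolding B by Groebner_Basis.algebra
    then show ?thesis using assms(2) by simp
  qed
qed

text \<open>The modular polynomial of the level 5 Hauptmodul: its six roots \<open>n\<close> correspond to the six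
  subgroups of order 5 of a curve with invariant \<open>j\<close>.\<close>

definition level5 :: "'a::comm_ring_1 \<Rightarrow> 'a \<Rightarrow> 'a" where
  "level5 j n = (n^2 - 10*n + 5)^3 + j*n"

text \<open>Under the Fricke involution \<open>n = 125/B\<close> the quadratics become
  \<open>n^2 - 10n + 5\<close>, \<open>n^2 - 4n - 1\<close> and \<open>n^2 - 22n + 125\<close>. The
  first occurs cubed in \<open>level5\<close>, the other two in the factorisation of
  \<open>level5 1728 n\<close>.\<close>

lemma level5_special:
  fixes B j :: "'a::field"
  assumes "(5::'a) \<noteq> 0" "B \<noteq> 0" "level5 j (125/B) = 0"
  shows "B^2 - 250*B + 3125 = 0 \<Longrightarrow> j = 0"
    and "B^2 + 500*B - 15625 = 0 \<Longrightarrow> j = 1728"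
    and "B^2 - 22*B + 125 = 0 \<Longrightarrow> j = 1728"
proof -
  define n where "n = 125/B"
  have nB: "n * B = 125" using assms by (simp add: n_def)
  have "n * B = 5^3" using nB by simp
  moreover have "(5::'a)^3 \<noteq> 0" using assms(1) by (rule power_not_zero)
  ultimately have n0: "n \<noteq> 0" by (metis mult_zero_left)
  have G: "(n^2 - 10*n + 5)^3 + j*n = 0" using assms(3) by (simp add: level5_def n_def)
  have "B^2 * (n^2 - 10*n + 5) = (n*B)^2 - 10*(n*B)*B + 5*B^2" by Groebner_Basis.algebra
  also have "\<dots> = 5 * (B^2 - 250*B + 3125)" unfolding nB by Groebner_Basis.algebra
  finally have "B^2 - 250*B + 3125 = 0 \<Longrightarrow> n^2 - 10*n + 5 = 0" using assms(2) by simp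
  then show "B^2 - 250*B + 3125 = 0 \<Longrightarrow> j = 0" using G n0 by simp
  have "(j - 1728) * n = ((n^2 - 10*n + 5)^3 + j*n) - (n^2 - 22*n + 125) * (n^2 - 4*n - 1)^2"
    by Groebner_Basis.algebra
  then have j: "(n^2 - 22*n + 125) * (n^2 - 4*n - 1)^2 = 0 \<Longrightarrow> j = 1728"
    unfolding G using n0 by auto
  have "B^2 * (n^2 - 4*n - 1) = (n*B)^2 - 4*(n*B)*B - B^2" by Groebner_Basis.algebra
  also have "\<dots> = - (B^2 + 500*B - 15625)" unfolding nB by Groebner_Basis.algebra
  finally have "B^2 + 500*B - 15625 = 0 \<Longrightarrow> n^2 - 4*n - 1 = 0" using assms(2) by simp
  then show "B^2 + 500*B - 15625 = 0 \<Longrightarrow> j = 1728" using j by simp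
  have "B^2 * (n^2 - 22*n + 125) = (n*B)^2 - 22*(n*B)*B + 125*B^2" by Groebner_Basis.algebra
  also have "\<dots> = 125 * (B^2 - 22*B + 125)" unfolding nB by Groebner_Basis.algebra
  finally have "B^2 - 22*B + 125 = 0 \<Longrightarrow> n^2 - 22*n + 125 = 0" using assms(2) by simp
  then show "B^2 - 22*B + 125 = 0 \<Longrightarrow> j = 1728" using j by simp
qed

text \<open>With \<open>n = 125/B\<close> and \<open>n' = p^6/B\<close> one has
  \<open>p^2 (n^2 - 10n + 5) = 5 (n'^2 - 10n' + 5)\<close> and \<open>p^6 n = 125 n'\<close>. Hence
  \<open>125 * level5 j n' = p^6 * level5 j n\<close>.\<close>

lemma level5_root_transfer:
  fixes p B j :: "'a::field"
  assumes "(5::'a) \<noteq> 0" "B \<noteq> 0" "quint p = B" "level5 j (125/B) = 0"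
  shows "level5 j (p^6/B) = 0"
proof -
  define q n n' where "q = p^4 - 5*p^3 + 15*p^2 - 25*p + 25" and "n = 125/B" and "n' = p^6/B"
  have B: "B = p * q" unfolding assms(3)[symmetric] quint_def q_def by Groebner_Basis.algebra
  have p0: "p \<noteq> 0" "q \<noteq> 0" using assms(2) B by auto
  have nq: "n * (p * q) = 125" using assms(2) B by (simp add: n_def)
  have n'q: "n' * q = p^5" using p0 by (simp add: n'_def B power_eq_if[of p 6] power_eq_if[of p 5])
  have "(p*q)^2 * (n^2 - 10*n + 5) = (n*(p*q))^2 - 10*(n*(p*q))*(p*q) + 5*(p*q)^2"
    by Groebner_Basis.algebra
  also have "\<dots> = 5 * (p^10 - 10*p^5*q + 5*q^2)"
    unfolding nq unfolding q_def by Groebner_Basis.algebra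
  also have "p^10 - 10*p^5*q + 5*q^2 = (n'*q)^2 - 10*(n'*q)*q + 5*q^2"
    unfolding n'q by Groebner_Basis.algebra
  also have "\<dots> = q^2 * (n'^2 - 10*n' + 5)" by Groebner_Basis.algebra
  finally have "q^2 * (p^2 * (n^2 - 10*n + 5)) = q^2 * (5 * (n'^2 - 10*n' + 5))"
    by (simp add: power_mult_distrib mult_ac)
  then have e: "p^2 * (n^2 - 10*n + 5) = 5 * (n'^2 - 10*n' + 5)" using p0 by simp
  have "q * (p * (n * p^5)) = p^5 * (n * (p * q))" by Groebner_Basis.algebra
  also have "\<dots> = q * (125 * n')" unfolding nq n'q[symmetric] by (simp add: mult_ac)
  finally have e': "p^6 * n = 125 * n'"
    using p0 by (simp add: mult_ac power_eq_if[of p 6] power_eq_if[of p 5])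
  have "125 * ((n'^2 - 10*n' + 5)^3 + j*n') = (5 * (n'^2 - 10*n' + 5))^3 + j * (125 * n')"
    by Groebner_Basis.algebra
  also have "\<dots> = p^6 * ((n^2 - 10*n + 5)^3 + j*n)"
    unfolding e[symmetric] e'[symmetric] by Groebner_Basis.algebra
  also have "\<dots> = 0" using assms(4) by (simp add: level5_def n_def)
  finally have "5^3 * ((n'^2 - 10*n' + 5)^3 + j*n') = 0" by simp
  then have "(n'^2 - 10*n' + 5)^3 + j*n' = 0" using assms(1) by (metis mult_eq_0_iff power_not_zero)
  then show ?thesis by (simp add: level5_def n'_def)
qed

text \<open>The quantity \<open>n^2 - 22n + 125 = (n - 11)^2 + 4\<close> is the discriminant of
  \<open>x^2 - (n - 11) x - 1\<close>, which decides whether the \<open>x\<close> over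
  \<open>n\<close> are rational. For the new root it is an explicit square.\<close>

lemma level5_disc_transfer:
  fixes p B r :: "'a::field"
  assumes "B \<noteq> 0" "quint p = B" "r \<noteq> 0" "p = r - 1/r + 1"
  shows "(p^6/B)^2 - 22 * (p^6/B) + 125 =
    (p * (r + 1/r) * (p^4 - 10*p^3 + 45*p^2 - 100*p + 125) / B)^2"
proof -
  define i n where "i = 1/r" and "n = p^6/B"
  have ri: "r * i = 1" using assms by (simp add: i_def)
  have nB: "n * B = p^6" using assms by (simp add: n_def)
  have "(r + i)^2 = (r - i)^2 + 4 * (r * i)" by Groebner_Basis.algebra
  also have "\<dots> = (p - 1)^2 + 4" unfolding ri assms(4) i_def using assms(3) by simp
  finally have R: "(r + i)^2 = (p - 1)^2 + 4" .
  have "B^2 * (n^2 - 22*n + 125) = (n*B)^2 - 22*(n*B)*B + 125*B^2" by Groebner_Basis.algebra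
  also have "\<dots> = p^2 * ((p - 1)^2 + 4) * (p^4 - 10*p^3 + 45*p^2 - 100*p + 125)^2"
    unfolding nB unfolding assms(2)[symmetric] quint_def by Groebner_Basis.algebra
  also have "\<dots> = (p * (r + i) * (p^4 - 10*p^3 + 45*p^2 - 100*p + 125))^2"
    unfolding R[symmetric] by (simp add: power_mult_distrib)
  finally show ?thesis
    using assms(1) by (simp add: power_divide nonzero_eq_divide_eq mult.commute i_def n_def)
qed

section \<open>Rational roots\<close>

locale alg_closed_field_4mod5 = alg_closed_field_pchar K l
  for K :: "'k::field itself" and l :: nat +
  assumes l_mod_5: "l mod 5 = 4"
begin

lemma prime_nonzero:
  assumes "prime p" "p \<noteq> l" shows "of_nat p \<noteq> (0::'k)"
  using of_nat_eq_0_iff_char_dvd[of p, where 'a='k] CHAR_eq assms prime_l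
  by (metis primes_dvd_imp_eq)

lemma two: "(2::'k) \<noteq> 0" and three: "(3::'k) \<noteq> 0" and five: "(5::'k) \<noteq> 0"
  using prime_nonzero[of 2] prime_nonzero[of 3] prime_nonzero[of 5] l_mod_5 by fastforce+

lemma power_l_root_of_unity: "z^5 = (1::'k) \<Longrightarrow> z ^ l = z^4"
proof -
  assume z: "z^5 = 1"
  have "z ^ l = z ^ (5 * (l div 5) + 4)" using l_mod_5 by (metis mult_div_mod_eq)
  then show ?thesis by (simp add: power_add power_mult z)
qed

lemma card_roots_of_unity: "finite {z::'k. z^5 = 1}" "card {z::'k. z^5 = 1} = 5"
proof -
  let ?p = "[:-1, 0, 0, 0, 0, 1:] :: 'k poly"
  have p: "poly ?p z = 0 \<longleftrightarrow> z^5 = 1" for z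
    by (simp add: eval_nat_numeral algebra_simps)
  have "card {z. poly ?p z = 0} = degree ?p"
  proof (rule card_roots_separable[OF closed])
    fix z assume "poly ?p z = 0"
    then have "z \<noteq> 0" using p by auto
    moreover have "poly (pderiv ?p) z = 5 * z^4"
      by (simp add: pderiv_pCons eval_nat_numeral algebra_simps)
    ultimately show "poly (pderiv ?p) z \<noteq> 0" using five by simp
  qed auto
  then show "card {z::'k. z^5 = 1} = 5" using p by simp
  show "finite {z::'k. z^5 = 1}" using poly_roots_finite[of ?p] p by simp
qed

text \<open>The Gauss sum \<open>2 (z + z^4) + 1\<close> squares to 5, and Frobenius merely swaps
  \<open>z\<close> and \<open>z^4\<close>.\<close>

lemma sqrt5_exists: "\<exists>s\<in>Fq 1. s^2 = 5"
proof -
  have "\<not> {z::'k. z^5 = 1} \<subseteq> {1}"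
    using card_roots_of_unity card_mono[of "{1::'k}" "{z. z^5 = 1}"] by auto
  then obtain z :: 'k where z: "z^5 = 1" "z \<noteq> 1" by auto
  have "(z - 1) * (z^4 + z^3 + z^2 + z + 1) = z^5 - 1" by Groebner_Basis.algebra
  then have c: "z^4 + z^3 + z^2 + z + 1 = 0" using z by simp
  define s where "s = 2 * (z + z^4) + 1"
  have "z ^ l = z^4" using power_l_root_of_unity z by blast
  moreover have "(z^4) ^ l = z"
  proof -
    have "(z^4) ^ l = (z ^ l)^4" by (simp add: mult.commute flip: power_mult)
    also have "\<dots> = (z^5)^3 * z" using \<open>z ^ l = z^4\<close> by (simp flip: power_mult power_Suc2)
    finally show ?thesis using z by simp
  qed
  ultimately have "z + z^4 \<in> Fq 1"
    using frob_add[of z "z^4" 1] by (simp add: Fq_def)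
  then have "s \<in> Fq 1" unfolding s_def by (intro Fq_add[OF Fq_mult[OF Fq_numeral] Fq_1])
  moreover have "s^2 = 4 * (z^5 * (z^3 + 2) + z^2 + z + z^4) + 1"
    unfolding s_def by Groebner_Basis.algebra
  then have "s^2 = 4 * (z^4 + z^3 + z^2 + z + 1) + 5"
    unfolding z by (simp add: algebra_simps)
  then have "s^2 = 5" unfolding c by simp
  ultimately show ?thesis by blast
qed

text \<open>The exponent \<open>3q + 2\<close> inverts 5 modulo \<open>l - 1\<close>, since
  \<open>5 (3q + 2) = 3 (l - 1) + 1\<close>.\<close>

lemma fifth_root_exists:
  assumes "y \<in> Fq 1" "y \<noteq> 0" shows "\<exists>r\<in>Fq 1. r^5 = y"
proof -
  define q where "q = l div 5"
  have l: "l = 5*q + 4" using l_mod_5 by (metis mult_div_mod_eq q_def)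
  have "(3*q + 2) * 5 = 3 * (l - 1) + 1" unfolding l by simp
  then have "(y ^ (3*q + 2))^5 = y ^ (3 * (l - 1) + 1)" by (metis power_mult)
  also have "\<dots> = (y ^ (l - 1))^3 * y"
    by (metis mult.commute power_add power_mult power_one_right)
  also have "\<dots> = y" using Fq_power_minus_1[OF assms] by simp
  finally show ?thesis using assms by blast
qed

lemma frob_diff: "(x - y :: 'k) ^ l = x ^ l - y ^ l"
  using frob_add[of "x - y" y 1] by simp

text \<open>The square root \<open>w\<close> of the discriminant is carried from \<open>n\<close> to
  \<open>n'\<close> so that the \<open>x\<close> over both are rational.\<close>

lemma level5_roots:
  assumes j: "j \<noteq> 0" "j \<noteq> 1728"
    and n: "n \<in> Fq 1" "level5 j n = 0" and w: "w \<in> Fq 1" "w^2 = n^2 - 22*n + 125"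
  obtains n' w' where "n' \<in> Fq 1" "n' \<noteq> n" "w' \<in> Fq 1" "w'^2 = n'^2 - 22*n' + 125"
    "\<And>k. k \<in> Fq 1 \<Longrightarrow> level5 j k = 0 \<longleftrightarrow> k = n \<or> k = n'"
proof -
  obtain s where s: "s \<in> Fq 1" "s^2 = 5" using sqrt5_exists by blast
  have "(5::'k)^3 \<noteq> 0" using five by (rule power_not_zero)
  then have "(125::'k) \<noteq> 0" by simp
  then have n0: "n \<noteq> 0" using n(2) by (auto simp: level5_def)
  define B where "B = 125/n"
  have B: "B \<in> Fq 1" "B \<noteq> 0" using n(1) n0 \<open>125 \<noteq> 0\<close> by (auto simp: B_def)
  have nB: "n = 125/B" using n0 \<open>125 \<noteq> 0\<close> by (simp add: B_def)
  have lev: "level5 j (125/B) = 0" using n(2) nB by simp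
  note special = level5_special[OF five B(2) lev]
  have ne: "B^2 - 250*B + 3125 \<noteq> 0" "B^2 + 500*B - 15625 \<noteq> 0" "B^2 - 22*B + 125 \<noteq> 0"
    using special j by auto
  \<comment> \<open>To solve \<open>y - 1/y = v\<close> a square root of
    \<open>v^2 + 4 = 125 w^2 / n^2\<close> is needed; the rational square root \<open>s\<close> of 5
    provides it.\<close>
  define v e where "v = B - 11" and "e = 5 * s * w / n"
  have "e^2 = 25 * s^2 * w^2 / n^2" by (simp add: e_def power_mult_distrib power_divide)
  also have "\<dots> = v^2 + 4"
    unfolding s w v_def B_def using n0 by (simp add: field_simps power2_eq_square)
  finally have e2: "e^2 = v^2 + 4" .
  define y where "y = (v + e) / 2"
  have yF: "y \<in> Fq 1" unfolding y_def v_def e_def using B s w n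
    by (auto intro!: Fq_divide Fq_add Fq_mult Fq_diff)
  have "2 * y = v + e" using two by (simp add: y_def)
  then have "(2 * y - v)^2 = v^2 + 4" using e2 by simp
  then have "4 * (y^2 - v * y - 1) = 0" by (simp add: power2_eq_square algebra_simps)
  moreover have "(4::'k) = 2 * 2" by simp
  then have "(4::'k) \<noteq> 0" using two by (metis mult_eq_0_iff)
  ultimately have y2: "y^2 - v * y - 1 = 0" by (metis mult_eq_0_iff)
  then have y0: "y \<noteq> 0" by auto
  have "y * (y - v) = 1" using y2 by (simp add: algebra_simps power2_eq_square)
  then have yv: "y - 1/y + 11 = B" using y0 by (simp add: field_simps v_def)
  obtain r where r: "r \<in> Fq 1" "r^5 = y" using fifth_root_exists[OF yF y0] by blast
  have r0: "r \<noteq> 0" using r y0 by auto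
  define p where "p = (\<lambda>z. z * r - 1/(z * r) + 1)"
  let ?Z = "{z::'k. z^5 = 1}"
  have quint_p: "quint (p z) = B" if "z \<in> ?Z" for z
  proof -
    have "z \<noteq> 0" using that by auto
    then have "quint (p z) = (z * r)^5 - 1/(z * r)^5 + 11"
      unfolding p_def using r0 by (intro quint_R) simp
    then show ?thesis using that yv by (simp add: power_mult_distrib r(2))
  qed
  \<comment> \<open>A coincidence forces \<open>z z' r^2 = - 1\<close>, hence
    \<open>y^2 = - 1\<close> and \<open>B = 2y + 11\<close>, the remaining exceptional
    quadratic.\<close>
  have p_inj: "z = z'" if z: "z \<in> ?Z" "z' \<in> ?Z" and eq: "p z = p z'" for z z'
  proof (rule ccontr)
    assume neq: "z \<noteq> z'"
    have z0: "z \<noteq> 0" "z' \<noteq> 0" using z by auto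
    have "(z - z') * (z * z' * r^2 + 1) = (p z - p z') * (z * z' * r)"
      using z0 r0 by (simp add: p_def field_simps power2_eq_square)
    then have "z * z' * r^2 + 1 = 0" using eq neq by simp
    then have "z * z' * r^2 = - 1" by (simp add: eq_neg_iff_add_eq_0)
    then have "(z * z' * r^2)^5 = (- 1)^5" by simp
    moreover have "(z * z' * r^2)^5 = y^2"
      using z by (simp add: power_mult_distrib r(2)[symmetric] flip: power_mult)
    ultimately have "y^2 = - 1" by simp
    then have "y * y = - 1" by (simp add: power2_eq_square)
    then have "- (1/y) = y" using y0 by (simp add: field_simps)
    moreover have "B = y + - (1/y) + 11" using yv by simp
    ultimately have "B = 2 * y + 11" by (simp only: mult_2)
    then have "B^2 - 22*B + 125 = 4 * (y^2 + 1)" by (simp add: algebra_simps power2_eq_square)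
    then show False using ne(3) \<open>y^2 = - 1\<close> by simp
  qed
  have p6_inj: "z = z'" if z: "z \<in> ?Z" "z' \<in> ?Z" and eq: "p z ^ 6 = p z' ^ 6" for z z'
    using quint_eq_and_power6_eq[OF two three quint_p[OF z(1)] quint_p[OF z(2)] _ eq]
      p_inj[OF z] ne by blast
  define \<nu> where "\<nu> = (\<lambda>z. p z ^ 6 / B)"
  have \<nu>_inj: "z = z'" if "z \<in> ?Z" "z' \<in> ?Z" "\<nu> z = \<nu> z'" for z z'
    using p6_inj that B(2) by (simp add: \<nu>_def)
  have \<nu>_root: "level5 j (\<nu> z) = 0" if "z \<in> ?Z" for z
    unfolding \<nu>_def using level5_root_transfer[OF five B(2) quint_p[OF that] lev] .
  have \<nu>_n: "\<nu> z \<noteq> n" if "z \<in> ?Z" for z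
  proof
    assume "\<nu> z = n"
    then have "p z ^ 6 = 125" using B(2) nB by (simp add: \<nu>_def)
    then show False using quint_and_power6_125[OF quint_p[OF that]] ne by blast
  qed
  \<comment> \<open>A sextic has no room beyond \<open>n\<close> and the five distinct values of
    \<open>\<nu>\<close>.\<close>
  have roots: "{k. level5 j k = 0} = insert n (\<nu> ` ?Z)"
  proof -
    let ?g = "[:5, -10, 1:]^3 + [:0, j:] :: 'k poly"
    have g: "poly ?g k = level5 j k" for k
      by (simp add: level5_def algebra_simps power2_eq_square)
    have "degree ([:5, -10, 1:]^3 :: 'k poly) = 6" by (simp add: degree_power_eq)
    moreover have "degree [:0, j:] < 6" by simp
    ultimately have deg: "degree ?g = 6" by (metis degree_add_eq_left)
    then have g0: "?g \<noteq> 0" by (metis degree_0 zero_neq_numeral)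
    have "card (insert n (\<nu> ` ?Z)) = Suc (card (\<nu> ` ?Z))"
      using card_roots_of_unity(1) \<nu>_n by (subst card_insert_disjoint) auto
    also have "card (\<nu> ` ?Z) = 5"
    proof -
      have "inj_on \<nu> ?Z" by (rule inj_onI) (rule \<nu>_inj)
      then show ?thesis using card_image card_roots_of_unity(2) by metis
    qed
    finally have "card (insert n (\<nu> ` ?Z)) \<ge> card {k. poly ?g k = 0}"
      using card_poly_roots_bound[OF g0] deg by simp
    moreover have "insert n (\<nu> ` ?Z) \<subseteq> {k. poly ?g k = 0}"
      unfolding g using n(2) \<nu>_root by auto
    ultimately have "insert n (\<nu> ` ?Z) = {k. poly ?g k = 0}"
      using poly_roots_finite[OF g0] card_seteq by blast
    then show ?thesis unfolding g by simp
  qed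
  have frob_p: "p z ^ l = p (z^4)" if "z \<in> ?Z" for z
  proof -
    have "r ^ l = r" using r(1) by (simp add: Fq_def)
    then have "(z * r) ^ l = z^4 * r"
      using power_l_root_of_unity that by (simp add: power_mult_distrib)
    then show ?thesis
      using frob_add[of "z * r - 1/(z * r)" 1 1]
      by (simp add: p_def frob_diff power_one_over)
  qed
  \<comment> \<open>Frobenius sends \<open>\<nu> z\<close> to \<open>\<nu> (z^4)\<close>, so a
    rational value has \<open>z^4 = z\<close>, which together with \<open>z^5 = 1\<close> leaves
    \<open>z = 1\<close>.\<close>
  have \<nu>_rational: "z = 1" if z: "z \<in> ?Z" and F: "\<nu> z \<in> Fq 1" for z
  proof -
    have "(z^4)^5 = (z^5)^4" by (simp flip: power_mult)
    then have "z^4 \<in> ?Z" using z by (simp only: mem_Collect_eq power_one)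
    moreover have "\<nu> z ^ l = \<nu> (z^4)"
    proof -
      have "(p z ^ 6) ^ l = (p z ^ l) ^ 6" by (simp add: mult.commute flip: power_mult)
      moreover have "B ^ l = B" using B(1) by (simp add: Fq_def)
      ultimately show ?thesis using frob_p[OF z] by (simp add: \<nu>_def power_divide)
    qed
    then have "\<nu> (z^4) = \<nu> z" using F by (simp add: Fq_def)
    ultimately have z4: "z^4 = z" using \<nu>_inj z by blast
    have "z^5 = z^4 * z" by (simp add: eval_nat_numeral)
    then have "z^5 = z * z" unfolding z4 .
    then have z2: "z^2 = 1" using z by (simp add: power2_eq_square)
    have "z^4 = (z^2)^2" by simp
    then have "z^4 = 1" unfolding z2 by simp
    then show "z = 1" using z4 by simp
  qed
  have p1: "p 1 = r - 1/r + 1" by (simp add: p_def)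
  have p1F: "p 1 \<in> Fq 1" unfolding p1 using r by (auto intro!: Fq_add Fq_diff Fq_divide)
  define w' where "w' = p 1 * (r + 1/r) * (p 1^4 - 10*p 1^3 + 45*p 1^2 - 100*p 1 + 125) / B"
  have "w'^2 = \<nu> 1^2 - 22 * \<nu> 1 + 125"
    unfolding w'_def \<nu>_def
    using level5_disc_transfer[OF B(2) quint_p r0 p1] by simp
  moreover have "w' \<in> Fq 1"
    unfolding w'_def using p1F r B
    by (auto intro!: Fq_add Fq_diff Fq_divide Fq_mult Fq_power)
  moreover have "\<nu> 1 \<in> Fq 1" unfolding \<nu>_def using p1F B by (auto intro!: Fq_divide Fq_power)
  moreover have "\<nu> 1 \<noteq> n" using \<nu>_n by simp
  moreover have "level5 j k = 0 \<longleftrightarrow> k = n \<or> k = \<nu> 1" if "k \<in> Fq 1" for k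
  proof -
    have "level5 j k = 0 \<longleftrightarrow> k \<in> insert n (\<nu> ` ?Z)" using roots by blast
    also have "\<dots> \<longleftrightarrow> k = n \<or> k = \<nu> 1" using that \<nu>_rational by auto
    finally show ?thesis .
  qed
  ultimately show thesis using that by blast
qed

section \<open>From roots n of the sextic to roots x\<close>

lemma card_quadratic_roots:
  assumes "u \<in> Fq 1" "w \<in> Fq 1" "w \<noteq> 0" "w^2 = u^2 + 4"
  shows "finite {x\<in>Fq 1. x^2 - u*x - 1 = 0}" "card {x\<in>Fq 1. x^2 - u*x - 1 = 0} = 2"
proof -
  have "4 * (x^2 - u*x - 1) = (2*x - (u + w)) * (2*x - (u - w))" for x
  proof -
    have "4 * (x^2 - u*x - 1) = (2*x - u)^2 - (u^2 + 4)" by Groebner_Basis.algebra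
    also have "\<dots> = (2*x - u)^2 - w^2" using assms(4) by simp
    also have "\<dots> = (2*x - (u + w)) * (2*x - (u - w))" by Groebner_Basis.algebra
    finally show ?thesis .
  qed
  moreover have "(4::'k) = 2 * 2" by simp
  then have "(4::'k) \<noteq> 0" using two by (metis mult_eq_0_iff)
  ultimately have iff: "x^2 - u*x - 1 = 0 \<longleftrightarrow> 2*x = u + w \<or> 2*x = u - w" for x
    by (metis mult_eq_0_iff right_minus_eq)
  have "2*x = c \<longleftrightarrow> x = c/2" for x c :: 'k using two by (auto simp: field_simps)
  then have eq: "{x\<in>Fq 1. x^2 - u*x - 1 = 0} = {(u + w)/2, (u - w)/2}"
    using assms(1,2) iff by (auto intro!: Fq_divide)
  have "(u + w)/2 \<noteq> (u - w)/2"
  proof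
    assume "(u + w)/2 = (u - w)/2"
    then show False using two \<open>(4::'k) \<noteq> 0\<close> assms(3) by (simp add: eq_neg_iff_add_eq_0)
  qed
  then show "finite {x\<in>Fq 1. x^2 - u*x - 1 = 0}" "card {x\<in>Fq 1. x^2 - u*x - 1 = 0} = 2"
    unfolding eq by auto
qed

lemma card_two_quadratics:
  assumes "u \<in> Fq 1" "w \<in> Fq 1" "w \<noteq> 0" "w^2 = u^2 + 4"
    and "u' \<in> Fq 1" "w' \<in> Fq 1" "w' \<noteq> 0" "w'^2 = u'^2 + 4" and "u \<noteq> u'"
  shows "card {x\<in>Fq 1. x^2 - u*x - 1 = 0 \<or> x^2 - u'*x - 1 = 0} = 4"
proof -
  have "{x\<in>Fq 1. x^2 - u*x - 1 = 0 \<or> x^2 - u'*x - 1 = 0} =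
    {x\<in>Fq 1. x^2 - u*x - 1 = 0} \<union> {x\<in>Fq 1. x^2 - u'*x - 1 = 0}" by blast
  moreover have "x^2 - u*x - 1 \<noteq> 0 \<or> x^2 - u'*x - 1 \<noteq> 0" for x
  proof (rule ccontr)
    assume "\<not> ?thesis"
    then have *: "x^2 - u*x - 1 = 0" "x^2 - u'*x - 1 = 0" by auto
    then have "u*x = u'*x" by (simp add: algebra_simps)
    moreover have "x \<noteq> 0" using *(1) by auto
    ultimately show False using assms(9) by simp
  qed
  then have "{x\<in>Fq 1. x^2 - u*x - 1 = 0} \<inter> {x\<in>Fq 1. x^2 - u'*x - 1 = 0} = {}" by blast
  ultimately show ?thesis
    using card_quadratic_roots[OF assms(1-4)] card_quadratic_roots[OF assms(5-8)]
    by (simp add: card_Un_disjoint)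
qed

text \<open>A rational root makes the first discriminant a square; the product of both is the
  nonzero square \<open>c^2\<close>, so the second is a square as well.\<close>

lemma card_two_conjugate_quadratics:
  assumes u: "u \<in> Fq 1" "u' \<in> Fq 1" "u \<noteq> u'" and c: "c \<in> Fq 1" "c \<noteq> 0" "(u^2 + 4) * (u'^2 + 4) = c^2"
    and x: "x \<in> Fq 1" "x^2 - u*x - 1 = 0"
  shows "card {x\<in>Fq 1. x^2 - u*x - 1 = 0 \<or> x^2 - u'*x - 1 = 0} = 4"
proof -
  define w where "w = 2*x - u"
  have "w^2 = 4 * (x^2 - u*x - 1) + (u^2 + 4)" unfolding w_def by Groebner_Basis.algebra
  then have w2: "w^2 = u^2 + 4" unfolding x by simp
  have wF: "w \<in> Fq 1" unfolding w_def using x u by (auto intro!: Fq_diff Fq_mult)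
  have w0: "w \<noteq> 0" using w2 c by auto
  have "w^2 * (c/w)^2 = c^2" using w0 by (simp add: power_divide)
  also have "\<dots> = w^2 * (u'^2 + 4)" using c(3) w2 by simp
  finally have "(c/w)^2 = u'^2 + 4" using w0 by simp
  then show ?thesis
    using card_two_quadratics[OF u(1) wF w0 w2 u(2), of "c/w"] c wF w0 u by auto
qed

lemma nonzero_constants:
  "(4::'k) \<noteq> 0" "(12::'k) \<noteq> 0" "(27::'k) \<noteq> 0" "(36::'k) \<noteq> 0" "(1728::'k) \<noteq> 0" "(6912::'k) \<noteq> 0"
proof -
  have "(4::'k) = 2 ^ 2 * 3 ^ 0" "(12::'k) = 2 ^ 2 * 3 ^ 1" "(27::'k) = 2 ^ 0 * 3 ^ 3"
    "(36::'k) = 2 ^ 2 * 3 ^ 2" "(1728::'k) = 2 ^ 6 * 3 ^ 3" "(6912::'k) = 2 ^ 8 * 3 ^ 3"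
    by simp_all
  then show "(4::'k) \<noteq> 0" "(12::'k) \<noteq> 0" "(27::'k) \<noteq> 0" "(36::'k) \<noteq> 0" "(1728::'k) \<noteq> 0"
    "(6912::'k) \<noteq> 0"
    using two three by (metis mult_eq_0_iff power_not_zero)+
qed

text \<open>In terms of \<open>n = u + 11\<close> the quartic is \<open>n^2 - 10n + 5\<close>, whose
  roots are 5 plus or minus \<open>2 s\<close>. The product of the two discriminants is
  \<open>(12 s)^2\<close>.\<close>

lemma card_roots_f0:
  assumes "x \<in> Fq 1" "x^4 + 12*x^3 + 14*x^2 - 12*x + 1 = 0"
  shows "card {x\<in>Fq 1. x^4 + 12*x^3 + 14*x^2 - 12*x + 1 = 0} = 4"
proof -
  obtain s where s: "s \<in> Fq 1" "s^2 = 5" using sqrt5_exists by blast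
  have s0: "s \<noteq> 0" using s five by auto
  define u u' where "u = - 6 + 2*s" and "u' = - 6 - 2*s"
  have fac: "(x^2 - u*x - 1) * (x^2 - u'*x - 1) = x^4 + 12*x^3 + 14*x^2 - 12*x + 1" for x
  proof -
    have "(x^2 - u*x - 1) * (x^2 - u'*x - 1) = x^4 + 12*x^3 + (34 - 4*s^2)*x^2 - 12*x + 1"
      unfolding u_def u'_def by Groebner_Basis.algebra
    then show ?thesis unfolding s by simp
  qed
  have uF: "u \<in> Fq 1" "u' \<in> Fq 1"
    unfolding u_def u'_def using s by (auto intro!: Fq_add Fq_diff Fq_mult Fq_uminus)
  have "u - u' = 4 * s" by (simp add: u_def u'_def)
  then have neq: "u \<noteq> u'" using s0 nonzero_constants by auto
  have "(u^2 + 4) * (u'^2 + 4) = 16 * (s^2)^2 - 256 * s^2 + 1600"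
    unfolding u_def u'_def by Groebner_Basis.algebra
  also have "\<dots> = 144 * s^2" unfolding s by simp
  also have "\<dots> = (12 * s)^2" by (simp add: power_mult_distrib)
  finally have c: "(u^2 + 4) * (u'^2 + 4) = (12 * s)^2" .
  have cF: "12 * s \<in> Fq 1" "12 * s \<noteq> 0" using s s0 nonzero_constants by (auto intro!: Fq_mult)
  have "{x\<in>Fq 1. x^4 + 12*x^3 + 14*x^2 - 12*x + 1 = 0} =
      {x\<in>Fq 1. x^2 - u*x - 1 = 0 \<or> x^2 - u'*x - 1 = 0}"
    unfolding fac[symmetric] by auto
  moreover have "x^2 - u*x - 1 = 0 \<or> x^2 - u'*x - 1 = 0"
    using assms(2) unfolding fac[symmetric] by auto
  then have "card {x\<in>Fq 1. x^2 - u*x - 1 = 0 \<or> x^2 - u'*x - 1 = 0} = 4"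
  proof
    assume "x^2 - u*x - 1 = 0"
    then show ?thesis using card_two_conjugate_quadratics[OF uF neq cF c assms(1)] by simp
  next
    assume "x^2 - u'*x - 1 = 0"
    then show ?thesis
      using card_two_conjugate_quadratics[OF uF(2,1) _ cF _ assms(1)] neq c
      by (simp add: mult.commute disj_commute)
  qed
  ultimately show ?thesis by simp
qed

text \<open>Same pattern with \<open>n^2 - 4n - 1\<close>, whose roots are 2 plus or minus
  \<open>s\<close>, and with \<open>(36 s)^2\<close>.\<close>

lemma card_roots_f1728:
  assumes "x \<in> Fq 1" "x^4 + 18*x^3 + 74*x^2 - 18*x + 1 = 0"
  shows "card {x\<in>Fq 1. x^4 + 18*x^3 + 74*x^2 - 18*x + 1 = 0} = 4"
proof -
  obtain s where s: "s \<in> Fq 1" "s^2 = 5" using sqrt5_exists by blast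
  have s0: "s \<noteq> 0" using s five by auto
  define u u' where "u = - 9 + s" and "u' = - 9 - s"
  have fac: "(x^2 - u*x - 1) * (x^2 - u'*x - 1) = x^4 + 18*x^3 + 74*x^2 - 18*x + 1" for x
  proof -
    have "(x^2 - u*x - 1) * (x^2 - u'*x - 1) = x^4 + 18*x^3 + (79 - s^2)*x^2 - 18*x + 1"
      unfolding u_def u'_def by Groebner_Basis.algebra
    then show ?thesis unfolding s by simp
  qed
  have uF: "u \<in> Fq 1" "u' \<in> Fq 1"
    unfolding u_def u'_def using s by (auto intro!: Fq_add Fq_diff Fq_uminus)
  have "u - u' = 2 * s" by (simp add: u_def u'_def)
  then have neq: "u \<noteq> u'" using s0 two by auto
  have "(u^2 + 4) * (u'^2 + 4) = (s^2)^2 - 154 * s^2 + 7225"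
    unfolding u_def u'_def by Groebner_Basis.algebra
  also have "\<dots> = 1296 * s^2" unfolding s by simp
  also have "\<dots> = (36 * s)^2" by (simp add: power_mult_distrib)
  finally have c: "(u^2 + 4) * (u'^2 + 4) = (36 * s)^2" .
  have cF: "36 * s \<in> Fq 1" "36 * s \<noteq> 0" using s s0 nonzero_constants by (auto intro!: Fq_mult)
  have "{x\<in>Fq 1. x^4 + 18*x^3 + 74*x^2 - 18*x + 1 = 0} =
      {x\<in>Fq 1. x^2 - u*x - 1 = 0 \<or> x^2 - u'*x - 1 = 0}"
    unfolding fac[symmetric] by auto
  moreover have "x^2 - u*x - 1 = 0 \<or> x^2 - u'*x - 1 = 0"
    using assms(2) unfolding fac[symmetric] by auto
  then have "card {x\<in>Fq 1. x^2 - u*x - 1 = 0 \<or> x^2 - u'*x - 1 = 0} = 4"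
  proof
    assume "x^2 - u*x - 1 = 0"
    then show ?thesis using card_two_conjugate_quadratics[OF uF neq cF c assms(1)] by simp
  next
    assume "x^2 - u'*x - 1 = 0"
    then show ?thesis
      using card_two_conjugate_quadratics[OF uF(2,1) _ cF _ assms(1)] neq c
      by (simp add: mult.commute disj_commute)
  qed
  ultimately show ?thesis by simp
qed

lemma fj_level5:
  fixes x :: 'k
  assumes "x \<noteq> 0" and "n = x - 1/x + 11"
  shows "(x^4 + 12*x^3 + 14*x^2 - 12*x + 1)^3 - j * x^5 * (1 - 11*x - x^2) = x^6 * level5 j n"
proof -
  have xn: "x * n = x^2 + 11*x - 1" using assms by (simp add: field_simps power2_eq_square)
  have "x^2 * (n^2 - 10*n + 5) = (x*n)^2 - 10*x*(x*n) + 5*x^2" by Groebner_Basis.algebra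
  also have "\<dots> = x^4 + 12*x^3 + 14*x^2 - 12*x + 1" unfolding xn by Groebner_Basis.algebra
  finally have A: "x^4 + 12*x^3 + 14*x^2 - 12*x + 1 = x^2 * (n^2 - 10*n + 5)" by simp
  have C: "1 - 11*x - x^2 = - (x * n)" unfolding xn by simp
  show ?thesis unfolding A C level5_def by Groebner_Basis.algebra
qed

lemma card_roots_fj:
  fixes j :: 'k
  defines "f \<equiv> \<lambda>x. (x^4 + 12*x^3 + 14*x^2 - 12*x + 1)^3 - j * x^5 * (1 - 11*x - x^2)"
  assumes j: "j \<noteq> 0" "j \<noteq> 1728" and x: "x \<in> Fq 1" "f x = 0"
  shows "card {x\<in>Fq 1. f x = 0} = 4"
proof -
  have nz: "x \<noteq> 0" if "f x = 0" for x using that by (auto simp: f_def)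
  have f_lev: "f x = 0 \<longleftrightarrow> level5 j (x - 1/x + 11) = 0" if "x \<noteq> 0" for x
    unfolding f_def fj_level5[OF that refl] using that by simp
  have quad: "x^2 - (n - 11)*x - 1 = 0 \<longleftrightarrow> n = x - 1/x + 11" if "x \<noteq> 0" for x n :: 'k
    using that by (auto simp: field_simps power2_eq_square)
  define n w where "n = x - 1/x + 11" and "w = x + 1/x"
  have x0: "x \<noteq> 0" using nz x by blast
  have nF: "n \<in> Fq 1" "w \<in> Fq 1"
    unfolding n_def w_def using x by (auto intro!: Fq_add Fq_diff Fq_divide)
  have lev: "level5 j n = 0" using f_lev[OF x0] x n_def by simp
  have w2: "w^2 = n^2 - 22*n + 125"
    unfolding n_def w_def using x0 by (simp add: field_simps power2_eq_square)
  obtain n' w' where n': "n' \<in> Fq 1" "n' \<noteq> n" "w' \<in> Fq 1" "w'^2 = n'^2 - 22*n' + 125"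
    and lev': "\<And>k. k \<in> Fq 1 \<Longrightarrow> level5 j k = 0 \<longleftrightarrow> k = n \<or> k = n'"
    using level5_roots[OF j nF(1) lev nF(2) w2] by metis
  \<comment> \<open>A vanishing discriminant would give \<open>(j - 1728) n = 0\<close>, while
    \<open>n = 0\<close> would give \<open>125 = 0\<close>.\<close>
  have w_nz: "w \<noteq> 0" if "w^2 = n^2 - 22*n + 125" "level5 j n = 0" for w n
  proof
    assume "w = 0"
    then have "n^2 - 22*n + 125 = 0" using that by simp
    moreover have "(j - 1728) * n = level5 j n - (n^2 - 22*n + 125) * (n^2 - 4*n - 1)^2"
      unfolding level5_def by Groebner_Basis.algebra
    ultimately have "(j - 1728) * n = 0" using that by simp
    then have "n = 0" using j by simp
    have "(5::'k)^3 \<noteq> 0" using five by (rule power_not_zero)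
    then show False using that(2) \<open>n = 0\<close> by (simp add: level5_def)
  qed
  have "{x\<in>Fq 1. f x = 0} = {x\<in>Fq 1. x^2 - (n - 11)*x - 1 = 0 \<or> x^2 - (n' - 11)*x - 1 = 0}"
  proof (rule Collect_cong, rule conj_cong[OF refl])
    fix x assume xF: "x \<in> Fq 1"
    show "f x = 0 \<longleftrightarrow> x^2 - (n - 11)*x - 1 = 0 \<or> x^2 - (n' - 11)*x - 1 = 0"
    proof (cases "x = 0")
      case True
      then show ?thesis by (simp add: f_def)
    next
      case False
      have "x - 1/x + 11 \<in> Fq 1" using xF by (auto intro!: Fq_add Fq_diff Fq_divide)
      then show ?thesis unfolding f_lev[OF False] quad[OF False] using lev' by auto
    qed
  qed
  also have "card \<dots> = 4"
  proof (rule card_two_quadratics)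
    show "w^2 = (n - 11)^2 + 4" using w2 by (simp add: power2_eq_square algebra_simps)
    show "w'^2 = (n' - 11)^2 + 4" using n' by (simp add: power2_eq_square algebra_simps)
    show "w \<noteq> 0" using w_nz w2 lev by blast
    show "w' \<noteq> 0" using w_nz n' lev' by blast
  qed (use nF n' in \<open>auto intro!: Fq_diff\<close>)
  finally show ?thesis .
qed

end

section \<open>Passage to the prime field\<close>

lemma num_distinct_linear_factors_eq:
  "num_distinct_linear_factors (f :: 'a::field poly) = card {x. poly f x = 0}"
proof -
  have "{g. monic g \<and> degree g = 1 \<and> g dvd f} = (\<lambda>x. [:- x, 1:]) ` {x. poly f x = 0}"
  proof (intro equalityI subsetI)
    fix g assume "g \<in> {g. monic g \<and> degree g = 1 \<and> g dvd f}"
    then have g: "monic g" "degree g = 1" "g dvd f" by auto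
    then obtain c d where cd: "g = [:c, d:]" by (metis degree1_coeffs)
    then have "d = 1" using g by (auto split: if_splits)
    then have "g = [:- (- c), 1:]" using cd by simp
    then show "g \<in> (\<lambda>x. [:- x, 1:]) ` {x. poly f x = 0}"
      using g(3) poly_eq_0_iff_dvd[of f "- c"] by blast
  qed (auto simp: poly_eq_0_iff_dvd)
  moreover have "inj_on (\<lambda>x. [:- x, 1:]) {x. poly f x = 0}" by (auto simp: inj_on_def)
  ultimately show ?thesis by (simp add: num_distinct_linear_factors_def card_image)
qed

lemma poly_f0: "poly f0 x = x^4 + 12*x^3 + 14*x^2 - 12*x + 1"
  by (simp add: f0_def algebra_simps eval_nat_numeral)

lemma poly_f1728: "poly f1728 x = x^4 + 18*x^3 + 74*x^2 - 18*x + 1"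
  by (simp add: f1728_def algebra_simps eval_nat_numeral)

lemma poly_fj:
  "poly (fj j) x = (x^4 + 12*x^3 + 14*x^2 - 12*x + 1)^3 - j * x^5 * (1 - 11*x - x^2)"
proof -
  have "poly [:1, -12, 14, 12, 1:] x = x^4 + 12*x^3 + 14*x^2 - 12*x + 1"
    using poly_f0[of x] by (simp add: f0_def)
  moreover have "poly [:1, -11, -1:] x = 1 - 11*x - x^2"
    by (simp add: algebra_simps power2_eq_square)
  ultimately show ?thesis
    by (simp only: fj_def poly_diff poly_power poly_smult poly_mult poly_monom mult_1 mult.assoc)
qed

context
  fixes K :: "'k::field itself"
  assumes closure: "is_alg_closure_of_Fp CARD('p::prime_card) K"
begin

lemma CHAR_closure: "CHAR('k) = CARD('p)"
proof -
  have "prime CARD('p)" "of_nat CARD('p) = (0::'k)"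
    using closure by (auto simp: is_alg_closure_of_Fp_def)
  then show ?thesis
    by (metis CHAR_not_1' One_nat_def of_nat_eq_0_iff_char_dvd prime_nat_iff)
qed

lemma alg_closed_field_pchar_closure: "alg_closed_field_pchar TYPE('k) CARD('p)"
  using closure CHAR_closure by unfold_locales (auto simp: is_alg_closure_of_Fp_def)

lemma of_int_mod_CARD: "of_int (i mod int CARD('p)) = (of_int i :: 'k)"
proof -
  have "of_nat CARD('p) = (0::'k)" using closure by (auto simp: is_alg_closure_of_Fp_def)
  have "of_int i = (of_int (int CARD('p) * (i div int CARD('p)) + i mod int CARD('p)) :: 'k)"
    by simp
  also have "\<dots> = of_int (i mod int CARD('p))"
    using \<open>of_nat CARD('p) = (0::'k)\<close> by (simp only: of_int_add of_int_mult of_int_of_nat_eq) simp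
  finally show ?thesis by simp
qed

lemma emb_add: "(emb (x + y :: 'p mod_ring) :: 'k) = emb x + emb y"
  by (simp add: emb_def to_int_mod_ring_add of_int_mod_CARD)

lemma emb_mult: "(emb (x * y :: 'p mod_ring) :: 'k) = emb x * emb y"
  by (simp add: emb_def to_int_mod_ring_mult of_int_mod_CARD)

lemma emb_0 [simp]: "(emb (0 :: 'p mod_ring) :: 'k) = 0" by (simp add: emb_def)
lemma emb_1 [simp]: "(emb (1 :: 'p mod_ring) :: 'k) = 1" by (simp add: emb_def)

lemma emb_uminus: "(emb (- x :: 'p mod_ring) :: 'k) = - emb x"
  using emb_add[of x "- x"] by (simp add: eq_neg_iff_add_eq_0 add.commute)

lemma emb_diff: "(emb (x - y :: 'p mod_ring) :: 'k) = emb x - emb y"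
  using emb_add[of x "- y"] by (simp add: emb_uminus)

lemma emb_power: "(emb (x ^ n :: 'p mod_ring) :: 'k) = emb x ^ n"
  by (induction n) (simp_all add: emb_mult)

lemma emb_of_nat: "(emb (of_nat n :: 'p mod_ring) :: 'k) = of_nat n"
  by (induction n) (simp_all add: emb_add)

lemma emb_numeral: "(emb (numeral n :: 'p mod_ring) :: 'k) = numeral n"
  using emb_of_nat[of "numeral n"] by simp

lemmas emb_simps = emb_add emb_mult emb_uminus emb_diff emb_power emb_numeral

lemma emb_eq_0: "(emb (x :: 'p mod_ring) :: 'k) = 0 \<longleftrightarrow> x = 0"
proof
  assume e: "(emb x :: 'k) = 0"
  show "x = 0"
  proof (rule ccontr)
    assume "x \<noteq> 0"
    then have "x * inverse x = 1" by simp
    then have "(emb x :: 'k) * emb (inverse x) = 1" by (metis emb_1 emb_mult)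
    then show False using e by simp
  qed
qed simp

lemma emb_inject: "(emb (x :: 'p mod_ring) :: 'k) = emb y \<longleftrightarrow> x = y"
  using emb_eq_0[of "x - y"] by (simp add: emb_diff)

text \<open>Images of integers are fixed by Frobenius; equality follows because both sets have
  \<open>l\<close> elements.\<close>

lemma range_emb: "range (emb :: 'p mod_ring \<Rightarrow> 'k) = alg_closed_field_pchar.Fq CARD('p) 1"
proof -
  interpret alg_closed_field_pchar K "CARD('p)" by (rule alg_closed_field_pchar_closure)
  have "range (emb :: 'p mod_ring \<Rightarrow> 'k) \<subseteq> Fq 1"
  proof (clarify)
    fix x :: "'p mod_ring"
    have "x = of_nat (nat (to_int_mod_ring x))"
      by (metis of_int_mod_ring_to_int_mod_ring of_int_of_int_mod_ring of_nat_nat range_to_int_mod_ring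
          atLeastLessThan_iff rangeI)
    then have "(emb x :: 'k) = of_nat (nat (to_int_mod_ring x))" using emb_of_nat by metis
    then show "(emb x :: 'k) \<in> Fq 1" by (metis Fq_of_nat)
  qed
  moreover have "card (range (emb :: 'p mod_ring \<Rightarrow> 'k)) = card (Fq 1)"
    using finite_card_Fq[of 1] emb_inject by (subst card_image) (auto simp: inj_def)
  ultimately show ?thesis using finite_card_Fq[of 1] by (intro card_subset_eq) auto
qed

lemma card_emb_roots:
  "card {x :: 'p mod_ring. Q (emb x :: 'k)} = card {x \<in> alg_closed_field_pchar.Fq CARD('p) 1. Q (x::'k)}"
proof -
  have "{x \<in> range (emb :: 'p mod_ring \<Rightarrow> 'k). Q x} = emb ` {x :: 'p mod_ring. Q (emb x)}"
    by auto
  moreover have "inj_on (emb :: 'p mod_ring \<Rightarrow> 'k) {x. Q (emb x)}"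
    by (simp add: emb_inject inj_on_def)
  ultimately show ?thesis unfolding range_emb[symmetric] by (simp add: card_image)
qed

lemma factors_f0:
  "num_distinct_linear_factors (f0 :: 'p mod_ring poly) =
    card {x \<in> alg_closed_field_pchar.Fq CARD('p) 1. (x::'k)^4 + 12*x^3 + 14*x^2 - 12*x + 1 = 0}"
proof -
  have "poly f0 x = 0 \<longleftrightarrow> (emb x :: 'k)^4 + 12*emb x^3 + 14*emb x^2 - 12*emb x + 1 = 0"
    for x :: "'p mod_ring"
    unfolding poly_f0 emb_eq_0[symmetric] emb_simps emb_1 ..
  then show ?thesis
    unfolding num_distinct_linear_factors_eq card_emb_roots[symmetric] by simp
qed

lemma factors_f1728:
  "num_distinct_linear_factors (f1728 :: 'p mod_ring poly) =
    card {x \<in> alg_closed_field_pchar.Fq CARD('p) 1. (x::'k)^4 + 18*x^3 + 74*x^2 - 18*x + 1 = 0}"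
proof -
  have "poly f1728 x = 0 \<longleftrightarrow> (emb x :: 'k)^4 + 18*emb x^3 + 74*emb x^2 - 18*emb x + 1 = 0"
    for x :: "'p mod_ring"
    unfolding poly_f1728 emb_eq_0[symmetric] emb_simps emb_1 ..
  then show ?thesis
    unfolding num_distinct_linear_factors_eq card_emb_roots[symmetric] by simp
qed

lemma factors_fj:
  "num_distinct_linear_factors (fj j :: 'p mod_ring poly) =
    card {x \<in> alg_closed_field_pchar.Fq CARD('p) 1.
      ((x::'k)^4 + 12*x^3 + 14*x^2 - 12*x + 1)^3 - emb j * x^5 * (1 - 11*x - x^2) = 0}"
proof -
  have "poly (fj j) x = 0 \<longleftrightarrow> ((emb x :: 'k)^4 + 12*emb x^3 + 14*emb x^2 - 12*emb x + 1)^3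
      - emb j * emb x^5 * (1 - 11*emb x - emb x^2) = 0"
    for x :: "'p mod_ring"
    unfolding poly_fj emb_eq_0[symmetric] emb_simps emb_1 ..
  then show ?thesis
    unfolding num_distinct_linear_factors_eq card_emb_roots[symmetric] by simp
qed

end

section \<open>Isomorphisms between Weierstrass models\<close>

fun ec_scale :: "'k::field \<Rightarrow> 'k ec_point \<Rightarrow> 'k ec_point" where
  "ec_scale u Inf = Inf"
| "ec_scale u (Pt x y) = Pt (u^2 * x) (u^3 * y)"

lemma on_curve_scale:
  assumes "u \<noteq> 0"
  shows "on_curve (u^4 * a) (u^6 * b) (ec_scale u P) \<longleftrightarrow> on_curve a b P"
proof (cases P)
  case (Pt x y)
  have "(u^3 * y)^2 = u^6 * y^2"
    "(u^2 * x)^3 + u^4 * a * (u^2 * x) + u^6 * b = u^6 * (x^3 + a*x + b)"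
    by Groebner_Basis.algebra+
  then show ?thesis using Pt assms by (auto simp del: power_mult_distrib)
qed simp

lemma ec_add_scale:
  assumes "u \<noteq> 0"
  shows "ec_add (u^4 * a) (ec_scale u P) (ec_scale u Q) = ec_scale u (ec_add a P Q)"
proof (cases P; cases Q)
  fix x1 y1 x2 y2 assume *: "P = Pt x1 y1" "Q = Pt x2 y2"
  define m where "m = (if x1 = x2 then (3 * x1^2 + a) / (2 * y1) else (y2 - y1) / (x2 - x1))"
  have opp: "u^3 * y1 = - (u^3 * y2) \<longleftrightarrow> y1 = - y2"
    using assms by (metis mult_left_cancel mult_minus_right power_not_zero)
  have m: "(if u^2 * x1 = u^2 * x2 then (3 * (u^2 * x1)^2 + u^4 * a) / (2 * (u^3 * y1))
      else (u^3 * y2 - u^3 * y1) / (u^2 * x2 - u^2 * x1)) = u * m"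
  proof (cases "x1 = x2")
    case True
    have "3 * (u^2 * x1)^2 + u^4 * a = u^3 * (u * (3 * x1^2 + a))" by Groebner_Basis.algebra
    moreover have "2 * (u^3 * y1) = u^3 * (2 * y1)" by simp
    ultimately have "(3 * (u^2 * x1)^2 + u^4 * a) / (2 * (u^3 * y1)) = u * (3 * x1^2 + a) / (2 * y1)"
      using assms by (metis mult_divide_mult_cancel_left power_not_zero)
    then show ?thesis using True by (simp add: m_def)
  next
    case False
    have "u^3 * y2 - u^3 * y1 = u^2 * (u * (y2 - y1))" "u^2 * x2 - u^2 * x1 = u^2 * (x2 - x1)"
      by Groebner_Basis.algebra+
    then have "(u^3 * y2 - u^3 * y1) / (u^2 * x2 - u^2 * x1) = u * (y2 - y1) / (x2 - x1)"
      using assms by (metis mult_divide_mult_cancel_left power_not_zero)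
    then show ?thesis using False assms by (simp add: m_def)
  qed
  have x: "(u * m)^2 - u^2 * x1 - u^2 * x2 = u^2 * (m^2 - x1 - x2)" by Groebner_Basis.algebra
  have y: "u * m * (u^2 * x1 - u^2 * (m^2 - x1 - x2)) - u^3 * y1 =
      u^3 * (m * (x1 - (m^2 - x1 - x2)) - y1)" by Groebner_Basis.algebra
  have "u^2 * x1 = u^2 * x2 \<longleftrightarrow> x1 = x2" using assms by simp
  then show ?thesis
    unfolding * ec_scale.simps ec_add.simps m m_def[symmetric] Let_def x y opp by simp
qed auto

lemma ec_mult_scale:
  "u \<noteq> 0 \<Longrightarrow> ec_mult (u^4 * a) n (ec_scale u P) = ec_scale u (ec_mult a n P)"
  by (induction n) (simp_all add: ec_add_scale)

lemma supersingular_scale: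
  fixes u :: "'k::field"
  assumes "u \<noteq> 0" "supersingular_curve l a b"
  shows "supersingular_curve l (u^4 * a) (u^6 * b)"
  unfolding supersingular_curve_def
proof (intro allI impI)
  fix P assume P: "on_curve (u^4 * a) (u^6 * b) P \<and> ec_mult (u^4 * a) l P = Inf"
  have "\<exists>Q. P = ec_scale u Q"
  proof (cases P)
    case Inf
    then show ?thesis by (intro exI[of _ Inf]) simp
  next
    case (Pt x y)
    then show ?thesis using assms(1) by (intro exI[of _ "Pt (x/u^2) (y/u^3)"]) simp
  qed
  then obtain Q where Q: "P = ec_scale u Q" by blast
  have "on_curve a b Q" using P Q on_curve_scale[OF assms(1)] by blast
  moreover have "ec_scale u (ec_mult a l Q) = Inf"
    using P Q ec_mult_scale[OF assms(1)] by metis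
  then have "ec_mult a l Q = Inf" by (cases "ec_mult a l Q") auto
  ultimately have "Q = Inf" using assms(2) by (auto simp: supersingular_curve_def)
  then show "P = Inf" using Q by simp
qed

section \<open>From a supersingular invariant to a rational root\<close>

context alg_closed_field_4mod5
begin

lemma l_gt_3: "l > 3"
  using prime_gt_1_nat[OF prime_l] l_mod_5 by presburger

text \<open>The last conclusion serves \<open>j = 1728\<close>, where the factor
  \<open>t^2 + 1\<close> of \<open>864 * b\<close> must be ruled out: a rational square root of
  \<open>- 1\<close> forces \<open>l\<close> to be 1 modulo 4, and then
  \<open>y^2 = x^3 + a x\<close> has nonzero Hasse invariant.\<close>

lemma supersingular_param:
  assumes "elliptic a b" "a \<in> Fq 1" "b \<in> Fq 1" "supersingular_curve l a b"
  obtains t M where "t \<in> Fq 1" "M \<noteq> 0"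
    "48 * a = - (M^4 * (t^4 - 12*t^3 + 14*t^2 + 12*t + 1))"
    "864 * b = M^6 * ((t^2 + 1) * (t^4 - 18*t^3 + 74*t^2 + 18*t + 1))"
    "b = 0 \<Longrightarrow> t^2 + 1 \<noteq> 0"
proof -
  interpret elliptic_curve_over_prime_field K l a b
    using two assms l_gt_3 by unfold_locales auto
  have h: "hasse 1 = 0" using supersingular_imp_hasse_0 assms by blast
  have "5 dvd l + 1" using l_mod_5 by presburger
  then have "5 dvd card (carrier (EG 1))" using card_EG_supersingular[OF h] by simp
  then obtain P where P: "P \<in> carrier (EG 1)" "P \<noteq> Inf" "ec_mult a 5 P = Inf"
    using torsion_point_exists[of 1 5] by auto
  then obtain t M where tM: "t \<in> Fq 1" "M \<noteq> 0" "t \<noteq> 0"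
    "48 * a = - (M^4 * (t^4 - 12*t^3 + 14*t^2 + 12*t + 1))"
    "864 * b = M^6 * ((t^2 + 1) * (t^4 - 18*t^3 + 74*t^2 + 18*t + 1))"
    using five_torsion_param[of P] by (auto simp: carrier_EG)
  have "t^2 + 1 \<noteq> 0" if "b = 0"
  proof
    assume "t^2 + 1 = 0"
    then have "4 dvd l - 1" using minus_1_square_imp tM by blast
    moreover have "a \<noteq> 0" using assms(1) that by (auto simp: elliptic_def)
    ultimately show False using hasse_j1728[OF that] h by blast
  qed
  then show thesis using that tM by blast
qed

lemma root_exists:
  assumes "n > 0" shows "\<exists>u::'k. u^n = c"
proof -
  have "degree (monom 1 n + [:-c:] :: 'k poly) = n"
    using assms by (subst degree_add_eq_left) (auto simp: degree_monom_eq)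
  then obtain u where "poly (monom 1 n + [:-c:]) u = 0" using closed assms by metis
  then show ?thesis by (auto simp: poly_monom)
qed

text \<open>The curve is rescaled to the rational model \<open>y^2 = x^3 + 1\<close>; then
  \<open>a = 0\<close> kills the quartic in \<open>t\<close>, and \<open>- t\<close> is the sought
  root.\<close>

lemma supersingular_j_0_roots:
  assumes "supersingular_j l (0::'k)"
  shows "card {x\<in>Fq 1. (x::'k)^4 + 12*x^3 + 14*x^2 - 12*x + 1 = 0} = 4"
proof -
  obtain a b :: 'k where ab: "elliptic a b" "j_invariant a b = 0" "supersingular_curve l a b"
    using assms by (auto simp: supersingular_j_def)
  then have a: "a = 0"
    using nonzero_constants by (auto simp: j_invariant_def elliptic_def)
  then have b: "b \<noteq> 0" using ab(1) by (auto simp: elliptic_def)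
  obtain u where u: "u^6 = 1/b" using root_exists[of 6] by auto
  have u0: "u \<noteq> 0" using u b by auto
  have "supersingular_curve l (0::'k) 1"
    using supersingular_scale[OF u0 ab(3)] a b u by simp
  moreover have "elliptic (0::'k) 1" using nonzero_constants by (simp add: elliptic_def)
  ultimately obtain t M where t: "t \<in> Fq 1" "M \<noteq> 0"
    "48 * (0::'k) = - (M^4 * (t^4 - 12*t^3 + 14*t^2 + 12*t + 1))"
    using supersingular_param[of 0 1] by (metis Fq_0 Fq_1)
  then have "t^4 - 12*t^3 + 14*t^2 + 12*t + 1 = 0" by auto
  then have "(- t)^4 + 12*(- t)^3 + 14*(- t)^2 - 12*(- t) + 1 = 0" by simp
  then show ?thesis using card_roots_f0[of "- t"] t(1) by auto
qed

text \<open>Here the rational model is \<open>y^2 = x^3 + x\<close>, and \<open>b = 0\<close> leaves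
  the quartic factor in \<open>t\<close>.\<close>

lemma supersingular_j_1728_roots:
  assumes "supersingular_j l (1728::'k)"
  shows "card {x\<in>Fq 1. (x::'k)^4 + 18*x^3 + 74*x^2 - 18*x + 1 = 0} = 4"
proof -
  obtain a b :: 'k where ab: "elliptic a b" "j_invariant a b = 1728" "supersingular_curve l a b"
    using assms by (auto simp: supersingular_j_def)
  then have "1728 * (4 * a^3) = 1728 * (4 * a^3 + 27 * b^2)"
    by (simp add: j_invariant_def elliptic_def nonzero_divide_eq_eq)
  then have "4 * a^3 = 4 * a^3 + 27 * b^2" unfolding mult_left_cancel[OF nonzero_constants(5)] .
  then have b: "b = 0" using nonzero_constants by simp
  then have a: "a \<noteq> 0" using ab(1) by (auto simp: elliptic_def)
  obtain u where u: "u^4 = 1/a" using root_exists[of 4] by auto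
  have u0: "u \<noteq> 0" using u a by auto
  have "supersingular_curve l (1::'k) 0"
    using supersingular_scale[OF u0 ab(3)] a b u by simp
  moreover have "elliptic (1::'k) 0" using nonzero_constants by (simp add: elliptic_def)
  ultimately obtain t M where t: "t \<in> Fq 1" "M \<noteq> 0"
    "864 * (0::'k) = M^6 * ((t^2 + 1) * (t^4 - 18*t^3 + 74*t^2 + 18*t + 1))"
    "(0::'k) = 0 \<Longrightarrow> t^2 + 1 \<noteq> 0"
    using supersingular_param[of 1 0] by (metis Fq_0 Fq_1)
  then have "t^4 - 18*t^3 + 74*t^2 + 18*t + 1 = 0" by auto
  then have "(- t)^4 + 18*(- t)^3 + 74*(- t)^2 - 18*(- t) + 1 = 0" by simp
  then show ?thesis using card_roots_f1728[of "- t"] t(1) by auto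
qed

text \<open>Up to powers of \<open>M\<close> the polynomials \<open>F\<close> and \<open>H\<close>
  play the roles of c4 and c6; the identity behind the result is
  \<open>F^3 - H^2 = 1728 t^5 (t^2 - 11t - 1)\<close>.\<close>

lemma invariant_of_param:
  assumes "M \<noteq> (0::'k)"
    and a: "48 * a = - (M^4 * (t^4 - 12*t^3 + 14*t^2 + 12*t + 1))"
    and b: "864 * b = M^6 * ((t^2 + 1) * (t^4 - 18*t^3 + 74*t^2 + 18*t + 1))"
    and j: "1728 * (4 * a^3) = j * (4 * a^3 + 27 * b^2)"
  shows "(t^4 - 12*t^3 + 14*t^2 + 12*t + 1)^3 = j * t^5 * (t^2 - 11*t - 1)"
proof -
  define F H where "F = t^4 - 12*t^3 + 14*t^2 + 12*t + 1"
    and "H = (t^2 + 1) * (t^4 - 18*t^3 + 74*t^2 + 18*t + 1)"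
  have "1728 * (4 * (48 * a)^3) = 48^3 * (1728 * (4 * a^3))" by (simp add: power_mult_distrib)
  also have "\<dots> = j * (4 * (48 * a)^3 + 4 * (864 * b)^2)"
    unfolding j by (simp add: power_mult_distrib algebra_simps)
  finally have "1728 * (4 * (- (M^4 * F))^3) = j * (4 * (- (M^4 * F))^3 + 4 * (M^6 * H)^2)"
    unfolding a b F_def H_def .
  moreover have "1728 * (4 * (- (M^4 * F))^3) = (4 * M^12) * (- (1728 * F^3))"
    "j * (4 * (- (M^4 * F))^3 + 4 * (M^6 * H)^2) = (4 * M^12) * (j * (H^2 - F^3))"
    by Groebner_Basis.algebra+
  moreover have "4 * M^12 \<noteq> 0" using assms(1) nonzero_constants by simp
  ultimately have "- (1728 * F^3) = j * (H^2 - F^3)" by (metis mult_left_cancel)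
  also have "\<dots> = - (1728 * (j * t^5 * (t^2 - 11*t - 1)))"
    unfolding F_def H_def by Groebner_Basis.algebra
  finally have "1728 * F^3 = 1728 * (j * t^5 * (t^2 - 11*t - 1))" by simp
  then show ?thesis unfolding mult_left_cancel[OF nonzero_constants(5)] F_def .
qed

lemma supersingular_j_generic_roots:
  assumes "supersingular_j l j" and j: "j \<in> Fq 1" "j \<noteq> 0" "j \<noteq> (1728::'k)"
  shows "card {x\<in>Fq 1. (x^4 + 12*x^3 + 14*x^2 - 12*x + 1)^3 - j * x^5 * (1 - 11*x - x^2) = 0} = 4"
proof -
  obtain a b :: 'k where ab: "elliptic a b" "j_invariant a b = j" "supersingular_curve l a b"
    using assms by (auto simp: supersingular_j_def)
  have disc: "4 * a^3 + 27 * b^2 \<noteq> 0" using ab(1) by (simp add: elliptic_def)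
  then have jeq: "1728 * (4 * a^3) = j * (4 * a^3 + 27 * b^2)"
    using ab(2) by (simp add: j_invariant_def nonzero_divide_eq_eq)
  have a0: "a \<noteq> 0" using ab(2) j by (auto simp: j_invariant_def)
  have b0: "b \<noteq> 0" using ab(2) j a0 nonzero_constants by (auto simp: j_invariant_def)
  \<comment> \<open>Scaling by \<open>u\<close> with \<open>u^2 = a/b\<close> turns both
    coefficients into \<open>c\<close>. The invariant determines
    \<open>c = 27 j / (4 (1728 - j))\<close>, so this model is defined over the prime field.\<close>
  define c where "c = a^3 / b^2"
  have cb: "c * b^2 = a^3" using b0 by (simp add: c_def)
  have c0: "c \<noteq> 0" using a0 b0 by (simp add: c_def)
  have "b^2 * (1728 * (4 * c)) = b^2 * (j * (4 * c + 27))"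
    using jeq unfolding cb[symmetric] by (simp add: algebra_simps)
  then have jc: "1728 * (4 * c) = j * (4 * c + 27)" using b0 by (metis mult_left_cancel power_not_zero)
  have "c * (4 * (1728 - j)) = 1728 * (4 * c) - j * (4 * c)" by Groebner_Basis.algebra
  also have "\<dots> = 27 * j" unfolding jc by Groebner_Basis.algebra
  finally have "c = 27 * j / (4 * (1728 - j))"
    using j nonzero_constants(1) by (metis mult_eq_0_iff nonzero_eq_divide_eq right_minus_eq)
  then have cF: "c \<in> Fq 1" using j by (auto intro!: Fq_divide Fq_mult Fq_diff)
  obtain u where u: "u^2 = a/b" using sqrt_exists by blast
  have u0: "u \<noteq> 0" using u a0 b0 by auto
  have "u^4 = (u^2)^2" "u^6 = (u^2)^3" by (simp_all flip: power_mult)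
  then have "u^4 * a = c" "u^6 * b = c"
    unfolding u c_def using b0
    by (simp_all add: power_divide power2_eq_square power3_eq_cube)
  then have ss: "supersingular_curve l c c" using supersingular_scale[OF u0 ab(3)] by simp
  have "b^2 * (4 * c + 27) = 4 * a^3 + 27 * b^2" unfolding cb[symmetric] by (simp add: algebra_simps)
  then have "4 * c + 27 \<noteq> 0" using disc by auto
  moreover have "4 * c^3 + 27 * c^2 = c^2 * (4 * c + 27)" by Groebner_Basis.algebra
  ultimately have "elliptic c c" using c0 by (simp add: elliptic_def)
  then obtain t M where t: "t \<in> Fq 1" "M \<noteq> 0"
    "48 * c = - (M^4 * (t^4 - 12*t^3 + 14*t^2 + 12*t + 1))"
    "864 * c = M^6 * ((t^2 + 1) * (t^4 - 18*t^3 + 74*t^2 + 18*t + 1))"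
    using supersingular_param[OF _ cF cF ss] by metis
  have "1728 * (4 * c^3) = c^2 * (1728 * (4 * c))" by Groebner_Basis.algebra
  also have "\<dots> = j * (4 * c^3 + 27 * c^2)" unfolding jc by Groebner_Basis.algebra
  finally have "(t^4 - 12*t^3 + 14*t^2 + 12*t + 1)^3 = j * t^5 * (t^2 - 11*t - 1)"
    by (rule invariant_of_param[OF t(2-4)])
  moreover have "((- t)^4 + 12*(- t)^3 + 14*(- t)^2 - 12*(- t) + 1)^3 - j * (- t)^5 * (1 - 11*(- t) - (- t)^2)
      = (t^4 - 12*t^3 + 14*t^2 + 12*t + 1)^3 - j * t^5 * (t^2 - 11*t - 1)"
    by Groebner_Basis.algebra
  ultimately have "((- t)^4 + 12*(- t)^3 + 14*(- t)^2 - 12*(- t) + 1)^3 - j * (- t)^5 * (1 - 11*(- t) - (- t)^2) = 0"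
    by (simp only: diff_self)
  then show ?thesis using card_roots_fj[OF j(2,3) Fq_uminus[OF t(1)]] by blast
qed

end

theorem theorem1p2:
  fixes TYPE_K :: "'k::field itself"
  assumes "[CARD('p::prime_card) = 4] (mod 5)"
    and "is_alg_closure_of_Fp CARD('p) TYPE('k)"
  shows "(supersingular_j CARD('p) (0::'k)
            \<longrightarrow> num_distinct_linear_factors (f0 :: 'p mod_ring poly) = 4)
       \<and> (supersingular_j CARD('p) (1728::'k)
            \<longrightarrow> num_distinct_linear_factors (f1728 :: 'p mod_ring poly) = 4)
       \<and> (\<forall>j::'p mod_ring. j \<noteq> 0 \<and> j \<noteq> 1728 \<and> supersingular_j CARD('p) (emb j :: 'k)
            \<longrightarrow> num_distinct_linear_factors (fj j) = 4)"
proof -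
  interpret alg_closed_field_pchar "TYPE('k)" "CARD('p)"
    using alg_closed_field_pchar_closure[OF assms(2)] .
  interpret alg_closed_field_4mod5 "TYPE('k)" "CARD('p)"
    using assms(1) by unfold_locales (simp add: cong_def)
  have "num_distinct_linear_factors (fj j) = 4"
    if "j \<noteq> 0" "j \<noteq> 1728" "supersingular_j CARD('p) (emb j :: 'k)" for j :: "'p mod_ring"
  proof -
    have "(emb j :: 'k) \<in> Fq 1" using range_emb[OF assms(2)] by blast
    moreover have "(emb j :: 'k) \<noteq> 0" using emb_eq_0[OF assms(2)] that by blast
    moreover have "(emb j :: 'k) \<noteq> 1728"
      using emb_inject[OF assms(2), of j 1728] emb_numeral[OF assms(2)] that by simp
    ultimately show ?thesis
      using supersingular_j_generic_roots that(3) factors_fj[OF assms(2)] by simp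
  qed
  then show ?thesis
    using supersingular_j_0_roots supersingular_j_1728_roots factors_f0[OF assms(2)]
      factors_f1728[OF assms(2)] by simp
qed

end
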